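(* Let $R(z)$ be a $p\times p$ self-adjoint rational matrix function with a matrix fraction $R(z)=Q(z)P(z)^{-1}$, $z\notin\sigma(P)$, where $Q(z)$ is a $p\times p$ matrix polynomial and $P(z)$ is a monic $p\times p$ matrix polynomial with $\deg P\ge1$. Suppose that $Q(z)$ and $P(z)$ are right coprime and that $R(z)$ is a matrix-valued Herglotz-Nevanlinna function, written in the form $$R(z)=Az+B+\sum_{j=1}^r\frac{E_j}{\lambda_j-z},\quad z\notin\{\lambda_j\}_{j=1}^r,$$ where $A\succeq0$, $B=B^*$, $E_j\succeq0$ and $\{\lambda_j\}_{j=1}^r\subseteq\sigma(P)\cap\mathbb R$. Then $P(z)$ is simple, $\sigma(P)\subseteq\mathbb R$ and $$E_j=-l_j\,Q(\lambda_j)\,\frac{(\operatorname{adj}P)^{(l_j-1)}(\lambda_j)}{(\det P)^{(l_j)}(\lambda_j)},\quad j=1,\dots,r,$$ where $\lambda_1,\dots,\lambda_r$ are all the (distinct) zeros of $P(z)$ with multiplicities $l_1,\dots,l_r$, respectively. Moreover, for $j=1,\dots,r$, $E_j\ne0_p$ and $\operatorname{rank}E_j=l_j$ whenever $P(z)$ and $Q(z)$ have no common zeros.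
   Context: Here $p\in\mathbb N$; $A^*$ is the conjugate transpose; $\succeq0$ means self-adjoint and nonnegative definite; $0_p,I_p$ are the zero and identity $p\times p$ matrices. $\operatorname{adj}P$ is the adjugate matrix polynomial of $P$, and $(\cdot)^{(k)}$ denotes the $k$-th derivative in $z$. A $p\times p$ matrix polynomial $F(z)=\sum_{k=0}^n A_kz^{n-k}$ with $A_k\in\mathbb C^{p\times p}$, $A_0\ne0_p$, has degree $n$; it is monic if $A_0=I_p$, and regular if $\det F\not\equiv0$. A zero of $F$ is a $\lambda\in\mathbb C$ with $\det F(\lambda)=0$, its multiplicity being that as a root of $\det F$; $\sigma(F)$ is the set of zeros. $F$ is simple if it is regular and, for every zero $\lambda$, the multiplicity of $\lambda$ equals the nullity of $F(\lambda)$. $G(z)$ is a right divisor of $F(z)$ if $F(z)=C(z)G(z)$ for some matrix polynomial $C(z)$. A right common divisor of $F$ and $\widetilde F$ is a right divisor of both; it is a greatest right common divisor (GRCD) if every other right common divisor is a right divisor of it. $F$ and $\widetilde F$ are right coprime if any GRCD of them is unimodular, i.e. its determinant never vanishes in $\mathbb C$. A rational matrix function is a matrix function whose entries are complex rational functions. It is self-adjoint if $R(z)=R(\bar z)^*$ for all $z\in\mathbb C$ except the poles of its entries. $R$ is a matrix-valued Herglotz-Nevanlinna function if it is holomorphic on the open upper half-plane $\mathbb C_+$ and $\frac1{2\mathrm i}(R(z)-R(z)^* )\succeq0$ for all $z\in\mathbb C_+$. In the representation of $R$, some of the $E_j$ are a priori allowed to be $0_p$, so that $\{\lambda_j\}_{j=1}^r$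 can be taken to be all of $\sigma(P)$ when $\sigma(P)\subseteq\mathbb R$. *)

theory Defs
  imports
    "HOL-Complex_Analysis.Complex_Analysis"
    "Jordan_Normal_Form.Gauss_Jordan_Elimination"
    "Jordan_Normal_Form.Matrix_Kernel"
    "Jordan_Normal_Form.Schur_Decomposition"
    "Jordan_Normal_Form.DL_Rank"
begin

text \<open>
  A \<open>p \<times> p\<close> matrix polynomial is an element of \<open>carrier_mat p p\<close> over \<open>complex poly\<close>, so that
  its determinant and its adjugate are formed over the polynomial ring. The names \<open>det\<close>,
  \<open>mat\<close> and \<open>order\<close> are qualified because HOL-Analysis or HOL-Algebra has constants with the same
  base names.
\<close>

definition mp_eval :: "complex poly mat \<Rightarrow> complex \<Rightarrow> complex mat" where
  "mp_eval F z = map_mat (\<lambda>f. poly f z) F"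

definition mp_coeff :: "complex poly mat \<Rightarrow> nat \<Rightarrow> complex mat" where
  "mp_coeff F k = map_mat (\<lambda>f. coeff f k) F"

definition mp_deriv :: "nat \<Rightarrow> complex poly mat \<Rightarrow> complex poly mat" where
  "mp_deriv k F = map_mat (pderiv ^^ k) F"

text \<open>\<open>mp_coeff F k\<close> is the coefficient of \<open>z ^ k\<close>; the zero polynomial has no degree.\<close>

definition mp_has_degree :: "nat \<Rightarrow> complex poly mat \<Rightarrow> nat \<Rightarrow> bool" where
  "mp_has_degree p F n \<longleftrightarrow> F \<in> carrier_mat p p \<and> mp_coeff F n \<noteq> 0\<^sub>m p p \<and>
     (\<forall>k>n. mp_coeff F k = 0\<^sub>m p p)"

definition mp_monic_of_degree :: "nat \<Rightarrow> complex poly mat \<Rightarrow> nat \<Rightarrow> bool" where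
  "mp_monic_of_degree p F n \<longleftrightarrow> mp_has_degree p F n \<and> mp_coeff F n = 1\<^sub>m p"

definition mp_regular :: "complex poly mat \<Rightarrow> bool" where
  "mp_regular F \<longleftrightarrow> Determinant.det F \<noteq> 0"

definition mp_zeros :: "complex poly mat \<Rightarrow> complex set" where
  "mp_zeros F = {z. Determinant.det (mp_eval F z) = 0}"

definition mp_mult :: "complex poly mat \<Rightarrow> complex \<Rightarrow> nat" where
  "mp_mult F z = Polynomial.order z (Determinant.det F)"

definition mp_simple :: "complex poly mat \<Rightarrow> bool" where
  "mp_simple F \<longleftrightarrow> mp_regular F \<and> (\<forall>z\<in>mp_zeros F. mp_mult F z = kernel_dim (mp_eval F z))"

definition mp_unimodular :: "complex poly mat \<Rightarrow> bool" where
  "mp_unimodular F \<longleftrightarrow> (\<forall>z. Determinant.det (mp_eval F z) \<noteq> 0)"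

definition right_divisor :: "nat \<Rightarrow> complex poly mat \<Rightarrow> complex poly mat \<Rightarrow> bool" where
  "right_divisor p G F \<longleftrightarrow> G \<in> carrier_mat p p \<and> (\<exists>C\<in>carrier_mat p p. F = C * G)"

definition right_common_divisor ::
    "nat \<Rightarrow> complex poly mat \<Rightarrow> complex poly mat \<Rightarrow> complex poly mat \<Rightarrow> bool" where
  "right_common_divisor p G F F' \<longleftrightarrow> right_divisor p G F \<and> right_divisor p G F'"

definition is_grcd ::
    "nat \<Rightarrow> complex poly mat \<Rightarrow> complex poly mat \<Rightarrow> complex poly mat \<Rightarrow> bool" where
  "is_grcd p G F F' \<longleftrightarrow> right_common_divisor p G F F' \<and>
     (\<forall>H. right_common_divisor p H F F' \<longrightarrow> right_divisor p H G)"

definition right_coprime :: "nat \<Rightarrow> complex poly mat \<Rightarrow> complex poly mat \<Rightarrow> bool" where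
  "right_coprime p F F' \<longleftrightarrow> (\<forall>G. is_grcd p G F F' \<longrightarrow> mp_unimodular G)"

text \<open>
  Complex functions are total. A rational function is one given by a reduced fraction wherever
  the denominator does not vanish; its values at its poles are left unconstrained.
\<close>

definition rational_fun :: "(complex \<Rightarrow> complex) \<Rightarrow> bool" where
  "rational_fun f \<longleftrightarrow> (\<exists>n d. d \<noteq> 0 \<and> coprime n d \<and>
     (\<forall>z. poly d z \<noteq> 0 \<longrightarrow> f z = poly n z / poly d z))"

definition rational_mat_fun :: "nat \<Rightarrow> (complex \<Rightarrow> complex mat) \<Rightarrow> bool" where
  "rational_mat_fun p R \<longleftrightarrow> (\<forall>z. R z \<in> carrier_mat p p) \<and>
     (\<forall>a<p. \<forall>b<p. rational_fun (\<lambda>z. R z $$ (a, b)))"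

definition self_adjoint_mat_fun :: "nat \<Rightarrow> (complex \<Rightarrow> complex mat) \<Rightarrow> bool" where
  "self_adjoint_mat_fun p R \<longleftrightarrow>
     (\<forall>z. (\<forall>a<p. \<forall>b<p. \<not> is_pole (\<lambda>w. R w $$ (a, b)) z) \<longrightarrow> R z = mat_adjoint (R (cnj z)))"

text \<open>In the order on \<open>complex\<close> used here, \<open>0 \<le> c\<close> means that \<open>c\<close> is real and nonnegative.\<close>

definition nonneg_definite :: "nat \<Rightarrow> complex mat \<Rightarrow> bool" where
  "nonneg_definite p M \<longleftrightarrow> M \<in> carrier_mat p p \<and> mat_adjoint M = M \<and>
     (\<forall>v\<in>carrier_vec p. 0 \<le> (M *\<^sub>v v) \<bullet>c v)"

definition herglotz_nevanlinna :: "nat \<Rightarrow> (complex \<Rightarrow> complex mat) \<Rightarrow> bool" where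
  "herglotz_nevanlinna p R \<longleftrightarrow>
     (\<forall>a<p. \<forall>b<p. (\<lambda>z. R z $$ (a, b)) holomorphic_on {z. Im z > 0}) \<and>
     (\<forall>z. Im z > 0 \<longrightarrow> nonneg_definite p ((1 / (2 * \<i>)) \<cdot>\<^sub>m (R z - mat_adjoint (R z))))"

text \<open>
  The value \<open>A z + B + (\<Sum>j = 1..r. E j / (\<lambda> j - z))\<close>; the sum is written entrywise because the
  type \<open>mat\<close> is not a commutative monoid under addition.
\<close>

definition herglotz_expansion ::
    "nat \<Rightarrow> complex mat \<Rightarrow> complex mat \<Rightarrow> nat \<Rightarrow> (nat \<Rightarrow> complex mat) \<Rightarrow> (nat \<Rightarrow> complex) \<Rightarrow>
      complex \<Rightarrow> complex mat" where
  "herglotz_expansion p A B r E l z =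
     z \<cdot>\<^sub>m A + B + Matrix.mat p p (\<lambda>(a, b). \<Sum>j = 1..r. E j $$ (a, b) / (l j - z))"

end

theory Submission
  imports Defs
begin

text \<open>
  Right coprimeness gives polynomial matrices with \<open>X Q + Y P\<close> unimodular, since the left ideal
  generated by \<open>Q\<close> and \<open>P\<close> is principal; so \<open>Q \<alpha>\<close> and \<open>P \<alpha>\<close> have no common null vector.
  At a zero \<open>\<alpha>\<close> of \<open>P\<close>, clearing denominators turns the expansion of \<open>R\<close> into
  \<open>(z - \<alpha>) q Q = K P\<close> with \<open>q \<alpha> \<noteq> 0\<close> and \<open>K \<alpha> = - q \<alpha> E\<close>. If \<open>P F\<close> vanishes to second order at \<open>\<alpha>\<close>, then
  \<open>Q F\<close> vanishes at \<open>\<alpha>\<close>, hence so does \<open>F\<close>: \<open>P\<close> has no Jordan chains of length two. This means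
  \<open>P T = M D\<close> with \<open>T\<close> constant and invertible, \<open>D = diag (z - \<alpha>, \<dots>, z - \<alpha>, 1, \<dots>, 1)\<close> with as many
  factors \<open>z - \<alpha>\<close> as the nullity of \<open>P \<alpha>\<close>, and \<open>M \<alpha>\<close> invertible. The order of \<open>det P\<close>, the adjugate of
  \<open>P\<close> and the rank of the residue can be read off from this factorization. If \<open>E = 0\<close>, the same
  identity makes \<open>Q \<alpha>\<close> vanish on the kernel of \<open>P \<alpha>\<close>, so every zero of \<open>P\<close> is a pole of \<open>R\<close>.
\<close>

section \<open>Principal left ideals of square polynomial matrices\<close>

text \<open>The cofactors along row \<open>i\<close> do not involve that row, so Laplace expansion
  pairs the new row with column \<open>i\<close> of \<open>adj_mat G\<close>.\<close>

lemma det_replace_row: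
  fixes G S :: "'a :: comm_ring_1 mat"
  assumes G: "G \<in> carrier_mat p p" and S: "S \<in> carrier_mat p p" and i: "i < p" and a: "a < p"
  shows "Determinant.det (Matrix.mat p p (\<lambda>(r, c). if r = i then S $$ (a, c) else G $$ (r, c)))
    = (S * adj_mat G) $$ (a, i)" (is "Determinant.det ?G = _")
proof -
  have G': "?G \<in> carrier_mat p p" by simp
  have "mat_delete ?G i j = mat_delete G i j" for j
    using G i by (intro eq_matI) (auto simp: mat_delete_def)
  then have cof: "cofactor ?G i j = cofactor G i j" for j
    by (simp add: cofactor_def)
  have "Determinant.det ?G = (\<Sum>j<p. ?G $$ (i, j) * cofactor ?G i j)"
    by (rule laplace_expansion_row[OF G' i])
  also have "\<dots> = (\<Sum>j = 0..<p. S $$ (a, j) * cofactor G i j)"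
    using i by (intro sum.cong) (auto simp: cof)
  also have "\<dots> = (S * adj_mat G) $$ (a, i)"
    using G S i a by (auto simp: times_mat_def scalar_prod_def adj_mat_def intro!: sum.cong)
  finally show ?thesis .
qed

text \<open>A generator is an element \<open>G\<close> whose determinant is nonzero of least degree: if division of
  \<open>F\<close> by \<open>G\<close> left a remainder with a nonzero row, exchanging a row of \<open>G\<close> for it
  would give an element with a nonzero determinant of smaller degree.\<close>

lemma left_ideal_principal:
  fixes J :: "'a :: field poly mat set"
  assumes J: "J \<subseteq> carrier_mat p p"
    and add: "\<And>F G. F \<in> J \<Longrightarrow> G \<in> J \<Longrightarrow> F + G \<in> J"
    and mult: "\<And>C F. C \<in> carrier_mat p p \<Longrightarrow> F \<in> J \<Longrightarrow> C * F \<in> J"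
    and P: "P \<in> J" "Determinant.det P \<noteq> 0"
  shows "\<exists>G\<in>J. \<forall>F\<in>J. \<exists>C\<in>carrier_mat p p. F = C * G"
proof -
  define Good where "Good G \<longleftrightarrow> G \<in> J \<and> Determinant.det G \<noteq> 0" for G
  have "Good P" using P by (simp add: Good_def)
  from exists_least_iff[of "\<lambda>k. \<exists>G. Good G \<and> degree (Determinant.det G) = k"]
  obtain G where "Good G"
    and least: "\<And>G'. Good G' \<Longrightarrow> \<not> degree (Determinant.det G') < degree (Determinant.det G)"
    using \<open>Good P\<close> by metis
  then have GJ: "G \<in> J" and G0: "Determinant.det G \<noteq> 0" by (auto simp: Good_def)
  with J have G: "G \<in> carrier_mat p p" by auto
  note adj = adj_mat[OF G]
  have "\<exists>C\<in>carrier_mat p p. F = C * G" if FJ: "F \<in> J" for F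
  proof -
    from FJ J have F: "F \<in> carrier_mat p p" by auto
    \<comment> \<open>Formally F G^-1 is \<open>F * adj_mat G\<close> divided by
      \<open>det G\<close>; \<open>C\<close> is its polynomial part, obtained by entrywise
      division.\<close>
    define C where "C = Matrix.mat p p (\<lambda>(a, i). (F * adj_mat G) $$ (a, i) div Determinant.det G)"
    have C: "C \<in> carrier_mat p p" by (simp add: C_def)
    define S where "S = F + (- C) * G"
    have S: "S \<in> carrier_mat p p" using F C G by (simp add: S_def)
    have SJ: "S \<in> J" unfolding S_def using C by (intro add mult FJ GJ) auto
    have "S * adj_mat G = F * adj_mat G + (- C) * (G * adj_mat G)"
      unfolding S_def using F C G adj(1)
      by (subst add_mult_distrib_mat[of _ p p]) (auto simp: assoc_mult_mat[of _ p p _ p _ p])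
    also have "\<dots> = F * adj_mat G - Determinant.det G \<cdot>\<^sub>m C"
      unfolding adj(2) using F C adj(1)
      by (intro eq_matI) (auto simp: mult_smult_distrib[of _ p p _ p])
    finally have SG: "S * adj_mat G = F * adj_mat G - Determinant.det G \<cdot>\<^sub>m C" .
    have rem: "(S * adj_mat G) $$ (a, i) = (F * adj_mat G) $$ (a, i) mod Determinant.det G"
      if "a < p" "i < p" for a i
      unfolding SG using that F C adj(1)
      by (simp add: C_def minus_mult_div_eq_mod)
    have "(S * adj_mat G) $$ (a, i) = 0" if a: "a < p" and i: "i < p" for a i
    proof (rule ccontr)
      assume nz: "(S * adj_mat G) $$ (a, i) \<noteq> 0"
      define G' where "G' = Matrix.mat p p (\<lambda>(r, c). if r = i then S $$ (a, c) else G $$ (r, c))"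
      \<comment> \<open>The row exchange is a combination of \<open>G\<close> and \<open>S\<close>
        with constant left factors, so it stays in \<open>J\<close>.\<close>
      have "G' = Matrix.mat p p (\<lambda>(r, c). if r = c \<and> r \<noteq> i then 1 else 0) * G
        + Matrix.mat p p (\<lambda>(r, c). if r = i \<and> c = a then 1 else 0) * S"
        using G S a i
        by (intro eq_matI)
          (auto simp: G'_def scalar_prod_def if_distrib[of "\<lambda>x. x * _"] sum.delta' cong: if_cong)
      then have "G' \<in> J" by (auto intro!: add mult GJ SJ)
      moreover have det: "Determinant.det G' = (S * adj_mat G) $$ (a, i)"
        unfolding G'_def by (rule det_replace_row[OF G S i a])
      ultimately have "Good G'" using nz by (simp add: Good_def)
      moreover have "degree (Determinant.det G') < degree (Determinant.det G)"
        using degree_mod_less[OF G0, of "(F * adj_mat G) $$ (a, i)"] nz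
        unfolding det rem[OF a i] by auto
      ultimately show False using least by blast
    qed
    then have "S * adj_mat G = 0\<^sub>m p p" using S adj(1) by (intro eq_matI) auto
    then have "S * adj_mat G * G = 0\<^sub>m p p" using G by simp
    then have "Determinant.det G \<cdot>\<^sub>m S = 0\<^sub>m p p"
      using S G adj by (simp add: assoc_mult_mat[of _ p p _ p _ p] mult_smult_distrib[of _ p p _ p])
    then have "Determinant.det G * S $$ (a, i) = 0" if "a < p" "i < p" for a i
      using that S by (metis carrier_matD index_smult_mat(1) index_zero_mat(1))
    then have "S $$ (a, i) = 0" if "a < p" "i < p" for a i using that G0 by simp
    then have "F $$ (a, i) = (C * G) $$ (a, i)" if "a < p" "i < p" for a i
      using that F C G by (auto simp: S_def)
    then have "F = C * G" using F C G by (intro eq_matI) auto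
    with C show ?thesis by blast
  qed
  with GJ show ?thesis by blast
qed

section \<open>Evaluation at a point and right coprimeness\<close>

lemma comm_ring_hom_poly: "comm_ring_hom (\<lambda>f. poly f z)"
  by unfold_locales auto

lemma mp_eval_carrier [simp]: "F \<in> carrier_mat m n \<Longrightarrow> mp_eval F z \<in> carrier_mat m n"
  by (simp add: mp_eval_def)

lemma dim_mp_eval [simp]: "dim_row (mp_eval F z) = dim_row F" "dim_col (mp_eval F z) = dim_col F"
  by (simp_all add: mp_eval_def)

lemma mp_eval_mult:
  "F \<in> carrier_mat m n \<Longrightarrow> G \<in> carrier_mat n k \<Longrightarrow> mp_eval (F * G) z = mp_eval F z * mp_eval G z"
  unfolding mp_eval_def by (rule semiring_hom.mat_hom_mult) (unfold_locales, auto)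

lemma mp_eval_add:
  "F \<in> carrier_mat m n \<Longrightarrow> G \<in> carrier_mat m n \<Longrightarrow> mp_eval (F + G) z = mp_eval F z + mp_eval G z"
  by (intro eq_matI) (auto simp: mp_eval_def)

lemma det_mp_eval: "Determinant.det (mp_eval F z) = poly (Determinant.det F) z"
  unfolding mp_eval_def by (rule comm_ring_hom.hom_det[OF comm_ring_hom_poly])

text \<open>Multiplication by \<open>adj_mat A\<close> reduces the claim to cancelling the scalar
  \<open>det A\<close> entrywise, which works over any integral domain.\<close>

lemma mult_left_cancel_det:
  fixes A F :: "'a :: idom mat"
  assumes A: "A \<in> carrier_mat p p" "Determinant.det A \<noteq> 0" and F: "F \<in> carrier_mat p k"
    and AF: "A * F = 0\<^sub>m p k"
  shows "F = 0\<^sub>m p k"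
proof -
  note adj = adj_mat[OF A(1)]
  have "adj_mat A * A * F = 0\<^sub>m p k"
    using AF adj(1) A F by (simp add: assoc_mult_mat[of _ p p _ p _ k])
  then have "Determinant.det A \<cdot>\<^sub>m F = 0\<^sub>m p k"
    using F by (simp add: adj mult_smult_assoc_mat[of _ p p _ k])
  then have "Determinant.det A * F $$ (a, i) = 0" if "a < p" "i < k" for a i
    using that F by (metis carrier_matD index_smult_mat(1) index_zero_mat(1))
  then show ?thesis using F A by (intro eq_matI) auto
qed

text \<open>Coprimeness speaks about all GRCDs, so one must first be exhibited: a generator
  \<open>G\<close> of the left ideal spanned by \<open>Q\<close> and \<open>P\<close>. It is a
  combination of the two, so unimodularity of \<open>G\<close> rules out a common null vector of
  their values.\<close>

lemma right_coprime_eval: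
  assumes P: "P \<in> carrier_mat p p" "Determinant.det P \<noteq> 0" and Q: "Q \<in> carrier_mat p p"
    and cop: "right_coprime p Q P"
    and F: "F \<in> carrier_mat p k"
    and PF: "mp_eval P z * F = 0\<^sub>m p k" and QF: "mp_eval Q z * F = 0\<^sub>m p k"
  shows "F = 0\<^sub>m p k"
proof -
  define J where "J = {X * Q + Y * P | X Y. X \<in> carrier_mat p p \<and> Y \<in> carrier_mat p p}"
  have J: "J \<subseteq> carrier_mat p p" using P Q by (auto simp: J_def)
  have JI: "X * Q + Y * P \<in> J" if "X \<in> carrier_mat p p" "Y \<in> carrier_mat p p" for X Y
    using that by (auto simp: J_def)
  have PJ: "P \<in> J" using JI[of "0\<^sub>m p p" "1\<^sub>m p"] P Q by simp
  have QJ: "Q \<in> J" using JI[of "1\<^sub>m p" "0\<^sub>m p p"] P Q by simp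
  have comb: "A + B \<in> J" if "A \<in> J" "B \<in> J" for A B
  proof -
    from that obtain X Y X' Y' where XY: "X \<in> carrier_mat p p" "Y \<in> carrier_mat p p"
      "X' \<in> carrier_mat p p" "Y' \<in> carrier_mat p p" "A = X * Q + Y * P" "B = X' * Q + Y' * P"
      unfolding J_def by blast
    then have "A + B = (X + X') * Q + (Y + Y') * P"
      using P Q by (intro eq_matI) (auto simp: add_mult_distrib_mat[of _ p p])
    then show ?thesis using JI[of "X + X'" "Y + Y'"] XY by simp
  qed
  have mult: "C * A \<in> J" if C: "C \<in> carrier_mat p p" and "A \<in> J" for C A
  proof -
    from that obtain X Y where XY: "X \<in> carrier_mat p p" "Y \<in> carrier_mat p p"
      "A = X * Q + Y * P" unfolding J_def by blast
    then have "C * A = (C * X) * Q + (C * Y) * P"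
      using P Q C by (simp add: mult_add_distrib_mat[of _ p p _ p] assoc_mult_mat[of _ p p _ p _ p])
    then show ?thesis using JI[of "C * X" "C * Y"] XY C by simp
  qed
  from left_ideal_principal[OF J comb mult PJ P(2)]
  obtain G where GJ: "G \<in> J" and gen: "\<forall>A\<in>J. \<exists>C\<in>carrier_mat p p. A = C * G" by blast
  from GJ obtain X Y where XY: "X \<in> carrier_mat p p" "Y \<in> carrier_mat p p" "G = X * Q + Y * P"
    unfolding J_def by blast
  have G: "G \<in> carrier_mat p p" using GJ J by blast
  \<comment> \<open>A common right divisor of \<open>Q\<close> and \<open>P\<close> divides every
    combination \<open>X * Q + Y * P\<close>, in particular \<open>G\<close>.\<close>
  have "right_divisor p H G" if "right_common_divisor p H Q P" for H
  proof -
    from that obtain C D where CD: "H \<in> carrier_mat p p" "C \<in> carrier_mat p p" "D \<in> carrier_mat p p"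
      "Q = C * H" "P = D * H"
      unfolding right_common_divisor_def right_divisor_def by blast
    have "G = (X * C + Y * D) * H"
      unfolding XY(3) CD(4,5) using CD(1-3) XY(1,2)
      by (simp add: add_mult_distrib_mat[of _ p p] assoc_mult_mat[of _ p p _ p _ p])
    moreover have "X * C + Y * D \<in> carrier_mat p p" using XY CD by simp
    ultimately show ?thesis unfolding right_divisor_def using CD(1) by blast
  qed
  with gen G PJ QJ have "is_grcd p G Q P"
    unfolding is_grcd_def right_common_divisor_def right_divisor_def by blast
  with cop have uni: "Determinant.det (mp_eval G z) \<noteq> 0"
    unfolding right_coprime_def mp_unimodular_def by blast
  note ev = mp_eval_carrier[OF XY(1)] mp_eval_carrier[OF XY(2)]
    mp_eval_carrier[OF P(1)] mp_eval_carrier[OF Q]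
  have "mp_eval G z = mp_eval X z * mp_eval Q z + mp_eval Y z * mp_eval P z"
    unfolding XY(3) using XY(1,2) P Q by (simp add: mp_eval_add[of _ p p] mp_eval_mult[of _ p p _ p])
  then have "mp_eval G z * F = mp_eval X z * (mp_eval Q z * F) + mp_eval Y z * (mp_eval P z * F)"
    by (simp add: add_mult_distrib_mat[OF mult_carrier_mat[OF ev(1,4)] mult_carrier_mat[OF ev(2,3)] F]
      assoc_mult_mat[OF ev(1,4) F] assoc_mult_mat[OF ev(2,3) F])
  also have "\<dots> = 0\<^sub>m p k" unfolding PF QF using XY(1,2) by simp
  finally show ?thesis using mult_left_cancel_det[OF mp_eval_carrier[OF G] uni F] by blast
qed

section \<open>Regularity of monic matrix polynomials\<close>

text \<open>The bounds \<open>n\<close> and \<open>m\<close> may exceed the degrees. Every other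
  term of the convolution has a factor beyond its bound.\<close>

lemma coeff_mult_top:
  fixes f g :: "'a :: comm_semiring_0 poly"
  assumes f: "\<forall>k>n. coeff f k = 0" and g: "\<forall>k>m. coeff g k = 0"
  shows "coeff (f * g) (n + m) = coeff f n * coeff g m"
proof -
  have "coeff (f * g) (n + m) = (\<Sum>i\<le>n + m. coeff f i * coeff g (n + m - i))"
    by (rule coeff_mult)
  also have "\<dots> = (\<Sum>i\<in>{n}. coeff f i * coeff g (n + m - i))"
  proof (intro sum.mono_neutral_right ballI)
    fix i assume "i \<in> {..n + m} - {n}"
    then have "i > n \<or> n + m - i > m" by auto
    then show "coeff f i * coeff g (n + m - i) = 0" using f g by auto
  qed auto
  finally show ?thesis by simp
qed

text \<open>A singular \<open>P\<close> has a polynomial null vector \<open>v\<close>. If entry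
  \<open>i\<close> of \<open>v\<close> has the largest degree \<open>m\<close>, then the coefficient
  of z^(n+m) in entry \<open>i\<close> of \<open>P *\<^sub>v v\<close> is the leading coefficient of
  that entry of \<open>v\<close>, because the leading matrix of \<open>P\<close> is the
  identity.\<close>

lemma det_monic_nonzero:
  assumes "mp_monic_of_degree p P n"
  shows "Determinant.det P \<noteq> 0"
proof
  assume "Determinant.det P = 0"
  from assms have P: "P \<in> carrier_mat p p" and mon: "mp_coeff P n = 1\<^sub>m p"
    and high: "\<forall>k>n. mp_coeff P k = 0\<^sub>m p p"
    by (auto simp: mp_monic_of_degree_def mp_has_degree_def)
  have lead: "coeff (P $$ (i, j)) n = (if i = j then 1 else 0)" if "i < p" "j < p" for i j
    using arg_cong[OF mon, of "\<lambda>M. M $$ (i, j)"] that P by (simp add: mp_coeff_def)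
  have top: "coeff (P $$ (i, j)) k = 0" if "i < p" "j < p" "k > n" for i j k
    using arg_cong[OF high[rule_format, OF that(3)], of "\<lambda>M. M $$ (i, j)"] that P
    by (simp add: mp_coeff_def)
  from \<open>Determinant.det P = 0\<close> obtain v where v: "v \<in> carrier_vec p" "v \<noteq> 0\<^sub>v p" "P *\<^sub>v v = 0\<^sub>v p"
    using det_0_iff_vec_prod_zero[OF P] by blast
  \<comment> \<open>Zero entries are left out: the zero polynomial has degree 0 and could otherwise
    be chosen as an entry of largest degree.\<close>
  define I where "I = {i. i < p \<and> vec_index v i \<noteq> 0}"
  have "I \<noteq> {}" using v(1,2) by (auto simp: I_def)
  have finI: "finite ((\<lambda>i. degree (vec_index v i)) ` I)" by (simp add: I_def)
  with \<open>I \<noteq> {}\<close> have "Max ((\<lambda>i. degree (vec_index v i)) ` I) \<in> (\<lambda>i. degree (vec_index v i)) ` I"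
    by (intro Max_in) auto
  then obtain i where i: "i \<in> I" and "Max ((\<lambda>i. degree (vec_index v i)) ` I) = degree (vec_index v i)"
    by auto
  with Max_ge[OF finI] have max: "degree (vec_index v j) \<le> degree (vec_index v i)" if "j \<in> I" for j
    using that by auto
  define m where "m = degree (vec_index v i)"
  have ip: "i < p" using i by (simp add: I_def)
  have vm: "coeff (vec_index v j) k = 0" if "j < p" "k > m" for j k
    using that max[of j] by (cases "j \<in> I") (auto simp: I_def m_def intro: coeff_eq_0)
  have "(P *\<^sub>v v) = 0\<^sub>v p" by fact
  then have "0 = (\<Sum>j = 0..<p. P $$ (i, j) * vec_index v j)"
    using ip P v(1) by (auto simp: scalar_prod_def dest!: arg_cong[of _ _ "\<lambda>x. vec_index x i"])
  then have "0 = coeff (\<Sum>j = 0..<p. P $$ (i, j) * vec_index v j) (n + m)" by simp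
  also have "\<dots> = (\<Sum>j = 0..<p. coeff (P $$ (i, j)) n * coeff (vec_index v j) m)"
    unfolding coeff_sum using ip top vm by (intro sum.cong) (auto intro!: coeff_mult_top)
  also have "\<dots> = coeff (vec_index v i) m"
    using ip by (simp add: lead if_distrib[of "\<lambda>x. x * _"] sum.delta' cong: if_cong)
  finally show False using i by (auto simp: I_def m_def)
qed

section \<open>Bases adapted to a kernel, and the expansion with its poles cleared\<close>

text \<open>A basis of the kernel is extended by unit vectors to a basis of the whole space, which
  forms the columns of \<open>T\<close> with the kernel vectors first. The last property says that a
  kernel vector has no coordinates along the added columns.\<close>

lemma kernel_adapted_basis:
  fixes A :: "'a :: field mat"
  assumes A: "A \<in> carrier_mat p p"
  obtains T where "T \<in> carrier_mat p p" "Determinant.det T \<noteq> 0" "kernel_dim A \<le> p"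
    "\<And>k. k < kernel_dim A \<Longrightarrow> A *\<^sub>v col T k = 0\<^sub>v p"
    "\<And>v k. v \<in> carrier_vec p \<Longrightarrow> A *\<^sub>v (T *\<^sub>v v) = 0\<^sub>v p \<Longrightarrow> kernel_dim A \<le> k \<Longrightarrow> k < p
      \<Longrightarrow> vec_index v k = 0"
proof -
  interpret kernel p p A by unfold_locales (rule A)
  obtain B where B: "finite B" "basis B" using kernel_basis_exists[OF A] by blast
  have d: "kernel_dim A = card B" using Ker.dim_basis[OF B] by simp
  have Bk: "B \<subseteq> mat_kernel A" and li: "Ker.lin_indpt B" and gen: "Ker.span B = mat_kernel A"
    using B(2) unfolding Ker.basis_def by auto
  have Bc: "B \<subseteq> carrier_vec p" using Bk mat_kernel_carrier[OF A] by blast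
  have liB: "NC.lin_indpt B" using li lindep_same[OF Bk] by simp
  define S where "S = B \<union> set (unit_vecs p)"
  have S: "finite S" "S \<subseteq> carrier_vec p"
    using B(1) Bc unit_vecs_carrier by (auto simp: S_def)
  have "NC.span S = carrier_vec p"
    using NC.span_is_monotone[of "set (unit_vecs p)" S] NC.span_unit_vecs_is_carrier
      NC.span_is_subset2[OF S(2)] by (auto simp: S_def)
  from maximal_exists_superset[of S "\<lambda>T. T \<subseteq> S \<and> NC.lin_indpt T" B] S liB
  obtain U where U: "finite U" "maximal U (\<lambda>T. T \<subseteq> S \<and> NC.lin_indpt T)" "B \<subseteq> U"
    by (auto simp: S_def)
  then have Uc: "U \<subseteq> carrier_vec p" and Uli: "NC.lin_indpt U"
    using S by (auto simp: maximal_def)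
  have vs: "NC.vs (carrier_vec p) = NC.V" by (simp add: module_vec_def)
  have "card U = p"
    using NC.dim_span[OF S(2,1) U(2)] NC.dim_is_n unfolding \<open>NC.span S = carrier_vec p\<close> vs by simp
  obtain bs where bs: "set bs = B" "distinct bs" using finite_distinct_list[OF B(1)] by blast
  obtain ws where ws: "set ws = U - B" "distinct ws"
    using finite_distinct_list[of "U - B"] U(1) by blast
  define us where "us = bs @ ws"
  have us: "set us = U" "distinct us"
    using bs ws U(3) by (auto simp: us_def)
  have len: "length us = p" "length bs = card B"
    using us \<open>card U = p\<close> bs distinct_card by metis+
  define T where "T = mat_of_cols p us"
  have T: "T \<in> carrier_mat p p" using len unfolding T_def by (metis mat_of_cols_carrier(1))
  have cols: "cols T = us" using us(1) Uc by (simp add: T_def cols_mat_of_cols)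
  have col: "col T k = us ! k" if "k < p" for k
    using that cols T len(1) by (metis cols_nth carrier_matD(2))
  have dT: "Determinant.det T \<noteq> 0"
    using NC.det_rank_iff[OF T] NC.lin_indpt_full_rank[OF T] us Uli by (simp add: cols)
  have le: "kernel_dim A \<le> p" using d U \<open>card U = p\<close> card_mono by metis
  have k1: "A *\<^sub>v col T k = 0\<^sub>v p" if "k < kernel_dim A" for k
  proof -
    have "us ! k \<in> B" using that us len bs d by (auto simp: us_def nth_append)
    then show ?thesis using that le Bk mat_kernelD(2)[OF A] by (auto simp: col)
  qed
  have k2: "vec_index v k = 0"
    if v: "v \<in> carrier_vec p" and Av: "A *\<^sub>v (T *\<^sub>v v) = 0\<^sub>v p" and k: "kernel_dim A \<le> k" "k < p" for v k
  proof -
    have "T *\<^sub>v v \<in> mat_kernel A" using Av T v by (intro mat_kernelI[OF A]) auto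
    then have "T *\<^sub>v v \<in> NC.span B" using gen span_same[OF Bk] by simp
    from NC.finite_in_span[OF B(1) Bc this] obtain c where c: "NC.lincomb c B = T *\<^sub>v v" by auto
    \<comment> \<open>\<open>f\<close> extends the coefficients \<open>c\<close> by zero to all of
      \<open>U\<close>, so \<open>a\<close> is the coordinate vector of \<open>T *\<^sub>v v\<close>
      in the basis; injectivity of \<open>T\<close> then forces \<open>v = a\<close>.\<close>
    define f where "f u = (if u \<in> B then c u else 0)" for u
    define a where "a = vec p (\<lambda>i. f (col T i))"
    have a: "a \<in> carrier_vec p" by (simp add: a_def)
    have "T *\<^sub>v a = NC.lincomb f U"
      unfolding a_def using NC.mat_mult_eq_lincomb[OF T, of f] us len cols by simp
    also have "\<dots> = NC.lincomb c B"
    proof (rule eq_vecI)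
      fix i assume "i < dim_vec (NC.lincomb c B)"
      then have i: "i < p" using NC.lincomb_dim[OF B(1) Bc] by simp
      show "vec_index (NC.lincomb f U) i = vec_index (NC.lincomb c B) i"
        unfolding NC.lincomb_index[OF i Uc] NC.lincomb_index[OF i Bc]
        using U by (intro sum.mono_neutral_cong_right) (auto simp: f_def)
    qed (use NC.lincomb_dim[OF B(1) Bc] NC.lincomb_dim[OF U(1) Uc] in simp)
    finally have "T *\<^sub>v (v - a) = 0\<^sub>v p"
      using T v a by (simp add: c mult_minus_distrib_mat_vec[of _ p p])
    moreover have "v - a \<in> carrier_vec p" using v a by simp
    ultimately have "v - a = 0\<^sub>v p" using dT det_0_iff_vec_prod_zero_field[OF T] by blast
    then have "vec_index (v - a) k = 0" using k by simp
    then have "vec_index v k = vec_index a k" using v a k by simp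
    moreover have "col T k \<in> U - B"
      using k len ws d by (auto simp: col us_def nth_append dest!: nth_mem)
    ultimately show ?thesis using k by (simp add: a_def f_def)
  qed
  show ?thesis by (rule that[OF T dT le k1 k2])
qed

text \<open>The residue of the expansion at \<open>\<alpha>\<close>, up to sign, is the sum of the \<open>E j\<close> with \<open>lam j = \<alpha>\<close>:
  this is zero unless \<open>\<alpha>\<close> is one of the \<open>lam j\<close>.\<close>

lemma herglotz_expansion_clear_poles:
  fixes E :: "nat \<Rightarrow> complex mat" and lam :: "nat \<Rightarrow> complex" and \<alpha> :: complex and r :: nat
  assumes A: "A \<in> carrier_mat p p" and B: "B \<in> carrier_mat p p"
  defines "E0 \<equiv> Matrix.mat p p (\<lambda>(a, b). \<Sum>j | j \<in> {1..r} \<and> lam j = \<alpha>. E j $$ (a, b))"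
  obtains K q where "K \<in> carrier_mat p p" "poly q \<alpha> \<noteq> 0" "mp_eval K \<alpha> = (- poly q \<alpha>) \<cdot>\<^sub>m E0"
    "\<And>z. z \<notin> lam ` {1..r} \<Longrightarrow>
      mp_eval K z = ((z - \<alpha>) * poly q z) \<cdot>\<^sub>m herglotz_expansion p A B r E lam z"
proof -
  define I where "I = {j \<in> {1..r}. lam j \<noteq> \<alpha>}"
  define I' where "I' = {j. j \<in> {1..r} \<and> lam j = \<alpha>}"
  have fin: "finite I" "finite I'" by (auto simp: I_def I'_def)
  \<comment> \<open>\<open>q\<close> clears the poles other than \<alpha>, and \<open>qr j\<close>
    is \<open>q\<close> without the factor belonging to \<open>lam j\<close>.\<close>
  define q where "q = (\<Prod>i\<in>I. [:lam i, -1:])"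
  define qr where "qr j = (\<Prod>i\<in>I - {j}. [:lam i, -1:])" for j
  have q: "poly q z = (lam j - z) * poly (qr j) z" if "j \<in> I" for j z
    unfolding q_def qr_def by (subst prod.remove[OF fin(1) that]) (simp add: algebra_simps)
  \<comment> \<open>The terms with pole \<alpha> contribute (z - \<alpha>)/(\<alpha> - z) = -1,
    whence the minus sign before \<open>E0\<close>.\<close>
  define K where "K = Matrix.mat p p (\<lambda>(a, b). [:-\<alpha>, 1:] * q * [:B $$ (a, b), A $$ (a, b):]
    - Polynomial.smult (E0 $$ (a, b)) q + [:-\<alpha>, 1:] * (\<Sum>j\<in>I. Polynomial.smult (E j $$ (a, b)) (qr j)))"
  have K: "K \<in> carrier_mat p p" by (simp add: K_def)
  have "poly q \<alpha> \<noteq> 0" using fin by (auto simp: q_def poly_prod I_def)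
  moreover have "mp_eval K \<alpha> = (- poly q \<alpha>) \<cdot>\<^sub>m E0"
    by (intro eq_matI) (auto simp: mp_eval_def K_def E0_def)
  moreover have "mp_eval K z = ((z - \<alpha>) * poly q z) \<cdot>\<^sub>m herglotz_expansion p A B r E lam z"
    if z: "z \<notin> lam ` {1..r}" for z
  proof (intro eq_matI)
    fix a b
    assume "a < dim_row (((z - \<alpha>) * poly q z) \<cdot>\<^sub>m herglotz_expansion p A B r E lam z)"
      "b < dim_col (((z - \<alpha>) * poly q z) \<cdot>\<^sub>m herglotz_expansion p A B r E lam z)"
    then have ab: "a < p" "b < p" by (auto simp: herglotz_expansion_def)
    let ?e = "\<lambda>j. E j $$ (a, b)"
    have "(\<Sum>j = 1..r. ?e j / (lam j - z)) = (\<Sum>j\<in>I \<union> I'. ?e j / (lam j - z))"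
      by (intro sum.cong) (auto simp: I_def I'_def)
    also have "\<dots> = (\<Sum>j\<in>I. ?e j / (lam j - z)) + (\<Sum>j\<in>I'. ?e j / (lam j - z))"
      by (rule sum.union_disjoint[OF fin]) (auto simp: I_def I'_def)
    finally have split: "(z - \<alpha>) * poly q z * (\<Sum>j = 1..r. ?e j / (lam j - z)) =
      (z - \<alpha>) * (\<Sum>j\<in>I. poly q z * (?e j / (lam j - z)))
        + (\<Sum>j\<in>I'. (z - \<alpha>) * poly q z * (?e j / (lam j - z)))"
      by (simp add: distrib_left sum_distrib_left mult.assoc)
    have "(\<Sum>j\<in>I. poly q z * (?e j / (lam j - z))) = (\<Sum>j\<in>I. ?e j * poly (qr j) z)"
    proof (intro sum.cong refl)
      fix j assume "j \<in> I"
      then show "poly q z * (?e j / (lam j - z)) = ?e j * poly (qr j) z"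
        unfolding q[OF \<open>j \<in> I\<close>] using z by (auto simp: I_def)
    qed
    moreover have "(\<Sum>j\<in>I'. (z - \<alpha>) * poly q z * (?e j / (lam j - z))) = (\<Sum>j\<in>I'. - (?e j * poly q z))"
    proof (intro sum.cong refl)
      fix j assume "j \<in> I'"
      then have "z \<noteq> \<alpha>" "lam j = \<alpha>" using z by (auto simp: I'_def)
      then show "(z - \<alpha>) * poly q z * (?e j / (lam j - z)) = - (?e j * poly q z)"
        by (simp add: divide_simps) (simp add: algebra_simps)
    qed
    moreover have "\<dots> = - (E0 $$ (a, b) * poly q z)"
      using ab by (simp add: E0_def I'_def sum_negf sum_distrib_right)
    ultimately have "(z - \<alpha>) * poly q z * (\<Sum>j = 1..r. ?e j / (lam j - z)) =
      (z - \<alpha>) * (\<Sum>j\<in>I. ?e j * poly (qr j) z) - E0 $$ (a, b) * poly q z"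
      using split by simp
    then show "mp_eval K z $$ (a, b) =
      (((z - \<alpha>) * poly q z) \<cdot>\<^sub>m herglotz_expansion p A B r E lam z) $$ (a, b)"
      using ab A B by (simp add: mp_eval_def K_def herglotz_expansion_def poly_sum algebra_simps)
  qed (auto simp: mp_eval_def K_def herglotz_expansion_def)
  ultimately show ?thesis using that[OF K] by blast
qed

section \<open>Diagonal factors and Taylor coefficients at a point\<close>

text \<open>With \<open>x\<close> the factor z - \<alpha> and \<open>y = 1\<close> this is the local
  Smith form at \<alpha> of a matrix polynomial whose partial multiplicities there are at most one,
  \<open>d\<close> of them being one.\<close>

definition split_diag :: "nat \<Rightarrow> nat \<Rightarrow> 'a \<Rightarrow> 'a \<Rightarrow> 'a :: comm_ring_1 mat" where
  "split_diag p d x y = Matrix.mat p p (\<lambda>(i, j). if i = j then if i < d then x else y else 0)"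

lemma split_diag_carrier [simp]: "split_diag p d x y \<in> carrier_mat p p"
  by (simp add: split_diag_def)

lemma dim_split_diag [simp]: "dim_row (split_diag p d x y) = p" "dim_col (split_diag p d x y) = p"
  by (simp_all add: split_diag_def)

lemma mult_split_diag_index:
  "A \<in> carrier_mat m p \<Longrightarrow> i < m \<Longrightarrow> j < p \<Longrightarrow>
    (A * split_diag p d x y) $$ (i, j) = A $$ (i, j) * (if j < d then x else y)"
  by (simp add: split_diag_def scalar_prod_def if_distrib[of "\<lambda>x. _ * x"] sum.delta cong: if_cong)

lemma split_diag_mult_index:
  "A \<in> carrier_mat p m \<Longrightarrow> i < p \<Longrightarrow> j < m \<Longrightarrow>
    (split_diag p d x y * A) $$ (i, j) = (if i < d then x else y) * A $$ (i, j)"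
  by (simp add: split_diag_def scalar_prod_def if_distrib[of "\<lambda>x. x * _"] sum.delta' cong: if_cong)

lemma split_diag_mult: "split_diag p d x y * split_diag p d x' y' = split_diag p d (x * x') (y * y')"
  by (intro eq_matI)
    (auto simp: mult_split_diag_index[of _ p p] simp del: index_mult_mat(1), auto simp: split_diag_def)

lemma split_diag_same: "split_diag p d x x = x \<cdot>\<^sub>m 1\<^sub>m p"
  by (intro eq_matI) (auto simp: split_diag_def)

lemma smult_split_diag: "c \<cdot>\<^sub>m split_diag p d x y = split_diag p d (c * x) (c * y)"
  by (intro eq_matI) (auto simp: split_diag_def)

lemma mp_eval_split_diag: "mp_eval (split_diag p d x y) z = split_diag p d (poly x z) (poly y z)"
  by (intro eq_matI) (auto simp: split_diag_def mp_eval_def)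

lemma det_split_diag:
  fixes x y :: "'a :: idom"
  assumes "d \<le> p"
  shows "Determinant.det (split_diag p d x y) = x ^ d * y ^ (p - d)"
proof -
  have "Determinant.det (split_diag p d x y) = prod_list (diag_mat (split_diag p d x y))"
    by (rule det_upper_triangular[of _ p]) (auto simp: split_diag_def)
  also have "\<dots> = (\<Prod>i = 0..<p. if i < d then x else y)"
    unfolding prod_list_diag_prod by (simp add: split_diag_def)
  also have "\<dots> = (\<Prod>i = 0..<d. if i < d then x else y) * (\<Prod>i = d..<p. if i < d then x else y)"
    using assms prod.atLeastLessThan_concat[of 0 d p "\<lambda>i. if i < d then x else y"] by simp
  also have "(\<Prod>i = 0..<d. if i < d then x else y) = (\<Prod>i = 0..<d. x)"
    by (rule prod.cong) auto
  also have "(\<Prod>i = d..<p. if i < d then x else y) = (\<Prod>i = d..<p. y)"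
    by (rule prod.cong) auto
  finally show ?thesis by simp
qed

lemma smult_mat_cancel:
  fixes c :: "'a :: idom"
  assumes "c \<cdot>\<^sub>m A = c \<cdot>\<^sub>m B" "c \<noteq> 0"
  shows "A = B"
proof (rule eq_matI)
  show dim: "dim_row A = dim_row B" "dim_col A = dim_col B"
    using assms(1) by (metis index_smult_mat(2), metis index_smult_mat(3))
  fix i j assume ij: "i < dim_row B" "j < dim_col B"
  then have "c * A $$ (i, j) = c * B $$ (i, j)"
    using assms(1) dim by (metis index_smult_mat(1))
  then show "A $$ (i, j) = B $$ (i, j)" using assms(2) by simp
qed

lemma mp_eval_smult: "mp_eval (f \<cdot>\<^sub>m F) z = poly f z \<cdot>\<^sub>m mp_eval F z"
  by (intro eq_matI) (auto simp: mp_eval_def)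

lemma mp_eval_eq_0_factor:
  assumes F: "F \<in> carrier_mat m k" and 0: "mp_eval F \<alpha> = 0\<^sub>m m k"
  obtains W where "W \<in> carrier_mat m k" "F = [:-\<alpha>, 1:] \<cdot>\<^sub>m W"
proof
  show "map_mat (\<lambda>f. f div [:-\<alpha>, 1:]) F \<in> carrier_mat m k" using F by simp
  show "F = [:-\<alpha>, 1:] \<cdot>\<^sub>m map_mat (\<lambda>f. f div [:-\<alpha>, 1:]) F"
  proof (rule eq_matI)
    fix i j
    assume "i < dim_row ([:-\<alpha>, 1:] \<cdot>\<^sub>m map_mat (\<lambda>f. f div [:-\<alpha>, 1:]) F)"
      "j < dim_col ([:-\<alpha>, 1:] \<cdot>\<^sub>m map_mat (\<lambda>f. f div [:-\<alpha>, 1:]) F)"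
    then have ij: "i < m" "j < k" using F by auto
    then have "poly (F $$ (i, j)) \<alpha> = 0"
      using arg_cong[OF 0, of "\<lambda>M. M $$ (i, j)"] F by (simp add: mp_eval_def)
    then have "[:-\<alpha>, 1:] dvd F $$ (i, j)" by (simp add: poly_eq_0_iff_dvd)
    then show "F $$ (i, j) = ([:-\<alpha>, 1:] \<cdot>\<^sub>m map_mat (\<lambda>f. f div [:-\<alpha>, 1:]) F) $$ (i, j)"
      using ij F by (simp del: mult_pCons_left)
  qed (use F in auto)
qed

definition const_mp :: "complex mat \<Rightarrow> complex poly mat" where
  "const_mp A = map_mat (\<lambda>c. [:c:]) A"

lemma const_mp_carrier [simp]: "A \<in> carrier_mat m n \<Longrightarrow> const_mp A \<in> carrier_mat m n"
  by (simp add: const_mp_def)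

lemma mp_eval_const_mp [simp]: "mp_eval (const_mp A) z = A"
  by (intro eq_matI) (auto simp: mp_eval_def const_mp_def)

lemma det_const_mp: "Determinant.det (const_mp A) = [:Determinant.det A:]"
proof -
  have "comm_ring_hom (\<lambda>c :: complex. [:c:])" by unfold_locales auto
  then show ?thesis unfolding const_mp_def by (rule comm_ring_hom.hom_det)
qed

text \<open>With s = z - \<alpha>, one differentiation turns s^(k+1) f into s^k h, where h(\<alpha>)
  = (k+1) f(\<alpha>). The induction therefore has to keep \<open>f\<close> arbitrary.\<close>

lemma poly_higher_pderiv_power:
  fixes f :: "'a :: {idom, semiring_char_0} poly"
  shows "poly ((pderiv ^^ k) ([:-\<alpha>, 1:] ^ k * f)) \<alpha> = fact k * poly f \<alpha>"
proof (induction k arbitrary: f)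
  case (Suc k)
  define s :: "'a poly" where "s = [:-\<alpha>, 1:]"
  have s: "pderiv s = 1" "poly s \<alpha> = 0" by (simp_all add: s_def pderiv_pCons)
  define h where "h = Polynomial.smult (of_nat (Suc k)) f + s * pderiv f"
  have "pderiv (s ^ Suc k * f) = s ^ k * h"
    unfolding pderiv_mult pderiv_power_Suc s(1) h_def
    by (simp add: distrib_left mult.assoc mult.commute mult.left_commute del: of_nat_Suc)
  then have "(pderiv ^^ Suc k) (s ^ Suc k * f) = (pderiv ^^ k) (s ^ k * h)"
    unfolding funpow_Suc_right o_apply by simp
  moreover have "poly h \<alpha> = of_nat (Suc k) * poly f \<alpha>" by (simp add: h_def s(2) del: of_nat_Suc)
  ultimately show ?case
    using Suc.IH[of h] unfolding s_def[symmetric]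
    by (simp only: fact_Suc) (simp add: mult.assoc mult.left_commute del: of_nat_Suc funpow.simps)
qed simp

section \<open>Ranks of products and factorization at a point\<close>

text \<open>The right inverse makes \<open>W\<close> surjective, so both matrices have the same
  column space.\<close>

lemma rank_mult_right_invertible:
  fixes X W W' :: "'a :: field mat"
  assumes X: "X \<in> carrier_mat n p" and W: "W \<in> carrier_mat p p" and W': "W' \<in> carrier_mat p p"
    and inv: "W * W' = 1\<^sub>m p"
  shows "vec_space.rank n (X * W) = vec_space.rank n X"
proof -
  interpret vec_space "TYPE('a)" n .
  have XW: "X * W \<in> carrier_mat n p" using X W by simp
  have "col_space (X * W) = col_space X"
  proof (intro equalityI subsetI)
    fix y assume "y \<in> col_space (X * W)"
    then obtain x where x: "x \<in> carrier_vec p" "(X * W) *\<^sub>v x = y" "y \<in> carrier_vec n"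
      using col_space_eq[OF XW] XW X by auto
    then have "X *\<^sub>v (W *\<^sub>v x) = y" "W *\<^sub>v x \<in> carrier_vec p" using X W by auto
    with x(3) show "y \<in> col_space X" using col_space_eq[OF X] X by auto
  next
    fix y assume "y \<in> col_space X"
    then obtain x where x: "x \<in> carrier_vec p" "X *\<^sub>v x = y" "y \<in> carrier_vec n"
      using col_space_eq[OF X] X by auto
    have "(X * W) *\<^sub>v (W' *\<^sub>v x) = X *\<^sub>v ((W * W') *\<^sub>v x)" using X W W' x(1) by simp
    also have "\<dots> = y" using inv x by simp
    finally have "(X * W) *\<^sub>v (W' *\<^sub>v x) = y" .
    moreover have "W' *\<^sub>v x \<in> carrier_vec p" using W' x(1) by simp
    ultimately show "y \<in> col_space (X * W)" using col_space_eq[OF XW] XW X W x(3) by auto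
  qed
  then show ?thesis unfolding rank_def col_space_def by simp
qed

lemma rank_mult_split_diag:
  fixes U :: "'a :: field mat"
  assumes U: "U \<in> carrier_mat p p" "Determinant.det U \<noteq> 0" and c: "c \<noteq> 0" and d: "d \<le> p"
  shows "vec_space.rank p (U * split_diag p d c 0) = d"
proof -
  interpret vec_space "TYPE('a)" p .
  \<comment> \<open>\<open>V\<close> is invertible and shares its first \<open>d\<close> columns
    with \<open>X\<close>, which makes them independent; the other columns of \<open>X\<close> are
    zero.\<close>
  define V where "V = U * split_diag p d c 1"
  define X where "X = U * split_diag p d c 0"
  have V: "V \<in> carrier_mat p p" and X: "X \<in> carrier_mat p p" using U by (auto simp: V_def X_def)
  have dV: "Determinant.det V \<noteq> 0"
    using U c d by (simp add: V_def det_mult[of _ p] det_split_diag)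
  have colX: "col X j = (if j < d then col V j else 0\<^sub>v p)" if "j < p" for j
    using that U V X by (intro eq_vecI)
      (auto simp: X_def V_def mult_split_diag_index[of _ p p] simp del: index_mult_mat(1))
  define S where "S = col V ` {..<d}"
  have rankV: "rank V = p" using dV det_rank_iff[OF V] by simp
  have dist: "distinct (cols V)" using non_distinct_low_rank[OF V] rankV by auto
  have li: "lin_indpt (set (cols V))" by (rule full_rank_lin_indpt[OF V rankV dist])
  have "inj_on (col V) {..<p}"
    using dist V by (auto simp: distinct_conv_nth inj_on_def)
  then have "inj_on (col V) {..<d}" using d by (auto intro: inj_on_subset)
  then have card: "card S = d" by (simp add: S_def card_image)
  have "S \<subseteq> set (cols V)" using V d by (auto simp: S_def cols_def)
  then have liS: "lin_indpt S" using li subset_li_is_li by blast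
  have setX: "S \<subseteq> set (cols X)" "set (cols X) \<subseteq> insert (0\<^sub>v p) S"
    using d X colX by (force simp: S_def cols_def, auto simp: S_def cols_def)
  have "maximal S (\<lambda>T. T \<subseteq> set (cols X) \<and> lin_indpt T)"
    unfolding maximal_def
  proof (intro conjI allI impI)
    fix B assume B: "S \<subseteq> B \<and> B \<subseteq> set (cols X) \<and> lin_indpt B"
    then have "B \<subseteq> carrier_vec p" using cols_dim[of X] X by auto
    with B have "0\<^sub>v p \<notin> B" using vs_zero_lin_dep by auto
    with B setX show "B = S" by auto
  qed (use liS setX in auto)
  then show ?thesis using rank_card_indpt[OF X] card by (simp add: X_def)
qed

text \<open>Moving a basis of the kernel of \<open>P \<alpha>\<close> into the first \<open>d\<close> columns makes these columns
  divisible by \<open>z - \<alpha>\<close>.\<close>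

lemma local_factorization:
  fixes \<alpha> :: complex
  assumes P: "P \<in> carrier_mat p p"
  defines "d \<equiv> kernel_dim (mp_eval P \<alpha>)"
  obtains T M where "T \<in> carrier_mat p p" "Determinant.det T \<noteq> 0" "M \<in> carrier_mat p p" "d \<le> p"
    "P * const_mp T = M * split_diag p d [:-\<alpha>, 1:] 1"
    "\<And>v k. v \<in> carrier_vec p \<Longrightarrow> mp_eval P \<alpha> *\<^sub>v (T *\<^sub>v v) = 0\<^sub>v p \<Longrightarrow> d \<le> k \<Longrightarrow> k < p
      \<Longrightarrow> vec_index v k = 0"
proof -
  have A: "mp_eval P \<alpha> \<in> carrier_mat p p" using P by simp
  obtain T where T: "T \<in> carrier_mat p p" "Determinant.det T \<noteq> 0" "d \<le> p"
    and k1: "\<And>k. k < d \<Longrightarrow> mp_eval P \<alpha> *\<^sub>v col T k = 0\<^sub>v p"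
    and k2: "\<And>v k. v \<in> carrier_vec p \<Longrightarrow> mp_eval P \<alpha> *\<^sub>v (T *\<^sub>v v) = 0\<^sub>v p \<Longrightarrow> d \<le> k \<Longrightarrow> k < p
      \<Longrightarrow> vec_index v k = 0"
    unfolding d_def by (rule kernel_adapted_basis[OF A]) blast
  define X where "X = P * const_mp T"
  have X: "X \<in> carrier_mat p p" using P T by (simp add: X_def)
  define M where "M = Matrix.mat p p
    (\<lambda>(i, j). if j < d then X $$ (i, j) div [:-\<alpha>, 1:] else X $$ (i, j))"
  have M: "M \<in> carrier_mat p p" by (simp add: M_def)
  have "[:-\<alpha>, 1:] dvd X $$ (i, j)" if "i < p" "j < d" for i j
  proof -
    have "mp_eval X \<alpha> = mp_eval P \<alpha> * T"
      unfolding X_def using P T by (simp add: mp_eval_mult[of _ p p _ p])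
    then have "mp_eval X \<alpha> $$ (i, j) = vec_index (mp_eval P \<alpha> *\<^sub>v col T j) i"
      using that T P by simp
    then show ?thesis using k1[of j] that T X by (simp add: mp_eval_def poly_eq_0_iff_dvd)
  qed
  then have "X = M * split_diag p d [:-\<alpha>, 1:] 1"
    using X M by (intro eq_matI)
      (auto simp: mult_split_diag_index[of _ p p] M_def
        simp del: index_mult_mat(1) mult_pCons_left mult_pCons_right)
  then show ?thesis using that T M k2 unfolding X_def by blast
qed

section \<open>Determinant and adjugate from the local factorization\<close>

text \<open>This is the outcome of \<open>local_factorization\<close> at one point. The value of
  \<open>M\<close> at \<alpha> may still be singular here.\<close>

locale local_factor =
  fixes p d :: nat and \<alpha> :: complex and P M :: "complex poly mat" and T :: "complex mat"
  assumes P: "P \<in> carrier_mat p p" and M: "M \<in> carrier_mat p p" and T: "T \<in> carrier_mat p p"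
    and T0: "Determinant.det T \<noteq> 0" and dp: "d \<le> p"
    and PT: "P * const_mp T = M * split_diag p d [:-\<alpha>, 1:] 1"
    and ker: "\<And>v k. v \<in> carrier_vec p \<Longrightarrow> mp_eval P \<alpha> *\<^sub>v (T *\<^sub>v v) = 0\<^sub>v p \<Longrightarrow> d \<le> k \<Longrightarrow> k < p
      \<Longrightarrow> vec_index v k = 0"
begin

definition s :: "complex poly" where "s = [:-\<alpha>, 1:]"

definition g :: "complex poly" where
  "g = Polynomial.smult (1 / Determinant.det T) (Determinant.det M)"

text \<open>Formally P^-1 = T D^-1 M^-1 with D = diag(s, ..., s, 1, ..., 1), and \<open>N\<close> is
  this inverse multiplied by \<open>s * g\<close>. It is the adjugate of \<open>P\<close> freed from
  the factor \<open>s ^ (d - 1)\<close>, as \<open>adj_P\<close> shows.\<close>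

definition N :: "complex poly mat" where
  "N = [:1 / Determinant.det T:] \<cdot>\<^sub>m (const_mp T * (split_diag p d 1 s * adj_mat M))"

lemma s: "s \<noteq> 0" "poly s \<alpha> = 0"
  by (simp_all add: s_def)

lemma cT: "const_mp T \<in> carrier_mat p p"
  using T by simp

lemmas Pe = mp_eval_carrier[OF P, of \<alpha>] and Me = mp_eval_carrier[OF M, of \<alpha>]

text \<open>The two diagonal matrices \<open>split_diag p d s 1\<close> and
  \<open>split_diag p d 1 s\<close> multiply to \<open>s\<close> times the identity, so a factor
  \<open>s\<close> comes out of all columns at once.\<close>

lemma P_mult_complement:
  assumes X: "X \<in> carrier_mat p k"
  shows "P * (const_mp T * (split_diag p d 1 s * X)) = s \<cdot>\<^sub>m (M * X)"
proof -
  let ?D = "split_diag p d s 1" and ?D' = "split_diag p d 1 s"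
  have D: "?D \<in> carrier_mat p p" and D': "?D' \<in> carrier_mat p p" by simp_all
  note D'X = mult_carrier_mat[OF D' X] and MX = mult_carrier_mat[OF M X]
  have "P * (const_mp T * (?D' * X)) = (P * const_mp T) * (?D' * X)"
    by (rule assoc_mult_mat[OF P cT D'X, symmetric])
  also have "\<dots> = M * (?D * (?D' * X))"
    unfolding PT s_def[symmetric] by (rule assoc_mult_mat[OF M D D'X])
  also have "?D * (?D' * X) = (?D * ?D') * X"
    by (rule assoc_mult_mat[OF D D' X, symmetric])
  also have "?D * ?D' = s \<cdot>\<^sub>m 1\<^sub>m p" by (simp add: split_diag_mult split_diag_same)
  also have "s \<cdot>\<^sub>m 1\<^sub>m p * X = s \<cdot>\<^sub>m X" using X by (simp add: mult_smult_assoc_mat[OF one_carrier_mat X])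
  also have "M * (s \<cdot>\<^sub>m X) = s \<cdot>\<^sub>m (M * X)" by (rule mult_smult_distrib[OF M X])
  finally show ?thesis .
qed

lemma P_eval_mult_T: "mp_eval P \<alpha> * T = mp_eval M \<alpha> * split_diag p d 0 1"
  using arg_cong[OF PT, of "\<lambda>F. mp_eval F \<alpha>"] P cT M
  by (simp add: mp_eval_mult[of _ p p _ p] mp_eval_split_diag)

lemma det_P: "Determinant.det P = s ^ d * g"
proof -
  have "Determinant.det P * [:Determinant.det T:] = Determinant.det M * s ^ d"
    using arg_cong[OF PT, of Determinant.det] P cT M dp
    by (simp add: det_mult[of _ p] det_const_mp det_split_diag s_def del: mult_pCons_right mult_pCons_left)
  then have "Polynomial.smult (Determinant.det T) (Determinant.det P) = s ^ d * Determinant.det M"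
    by (simp add: mult.commute)
  then have "Polynomial.smult (1 / Determinant.det T) (Polynomial.smult (Determinant.det T) (Determinant.det P))
    = s ^ d * g" by (simp add: g_def)
  then show ?thesis using T0 by simp
qed

lemma poly_g: "poly g \<alpha> = Determinant.det (mp_eval M \<alpha>) / Determinant.det T"
  by (simp add: g_def det_mp_eval)

lemma N_carrier: "N \<in> carrier_mat p p"
  using cT adj_mat(1)[OF M] unfolding N_def
  by (auto intro!: mult_carrier_mat[of _ p p])

lemma P_mult_N: "P * N = (s * g) \<cdot>\<^sub>m 1\<^sub>m p"
proof -
  note X = mult_carrier_mat[OF cT mult_carrier_mat[OF split_diag_carrier adj_mat(1)[OF M]]]
  have "P * N = [:1 / Determinant.det T:] \<cdot>\<^sub>m (s \<cdot>\<^sub>m (Determinant.det M \<cdot>\<^sub>m 1\<^sub>m p))"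
    unfolding N_def mult_smult_distrib[OF P X] P_mult_complement[OF adj_mat(1)[OF M]] adj_mat(2)[OF M] ..
  then show ?thesis by (auto intro!: eq_matI simp: g_def)
qed

text \<open>The product \<open>adj_mat P * P * N\<close> is both \<open>s * g\<close> times the
  adjugate and \<open>det P\<close> times \<open>N\<close>. Since \<open>det P\<close> contains
  \<open>s * g\<close>, that factor cancels.\<close>

lemma adj_P:
  assumes g0: "g \<noteq> 0" and d: "d \<ge> 1"
  shows "adj_mat P = s ^ (d - 1) \<cdot>\<^sub>m N"
proof -
  note adj = adj_mat[OF P]
  have "adj_mat P * (P * N) = (s * g) \<cdot>\<^sub>m adj_mat P"
    unfolding P_mult_N using adj(1) by (simp add: mult_smult_distrib[of _ p p _ p])
  moreover have "Determinant.det P \<cdot>\<^sub>m N = adj_mat P * (P * N)"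
    using N_carrier assoc_mult_mat[OF adj(1) P N_carrier, symmetric]
    by (simp add: adj mult_smult_assoc_mat[of _ p p _ p])
  moreover have "Determinant.det P = s * g * s ^ (d - 1)"
    using d by (cases d) (simp_all add: det_P)
  moreover have "(s * g) \<cdot>\<^sub>m (s ^ (d - 1) \<cdot>\<^sub>m N) = (s * g * s ^ (d - 1)) \<cdot>\<^sub>m N"
    by (intro eq_matI) (auto simp: mult.assoc)
  ultimately have "(s * g) \<cdot>\<^sub>m adj_mat P = (s * g) \<cdot>\<^sub>m (s ^ (d - 1) \<cdot>\<^sub>m N)"
    by simp
  then show ?thesis by (rule smult_mat_cancel) (use s g0 in auto)
qed

end

section \<open>The residue of the fraction at a zero of the denominator\<close>

text \<open>\<open>K\<close> and \<open>q\<close> are those of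
  \<open>herglotz_expansion_clear_poles\<close>. Coprimeness is phrased with square matrices; a
  single null vector enters as a matrix that repeats it in every column.\<close>

locale local_fraction = local_factor +
  fixes Q K :: "complex poly mat" and q :: "complex poly" and E :: "complex mat"
  assumes Q: "Q \<in> carrier_mat p p" and K: "K \<in> carrier_mat p p" and E: "E \<in> carrier_mat p p"
    and q: "poly q \<alpha> \<noteq> 0"
    and KP': "K * P = ([:-\<alpha>, 1:] * q) \<cdot>\<^sub>m Q"
    and KE: "mp_eval K \<alpha> = (- poly q \<alpha>) \<cdot>\<^sub>m E"
    and coprime_at: "\<And>F. F \<in> carrier_mat p p \<Longrightarrow> mp_eval P \<alpha> * F = 0\<^sub>m p p
      \<Longrightarrow> mp_eval Q \<alpha> * F = 0\<^sub>m p p \<Longrightarrow> F = 0\<^sub>m p p"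
begin

lemma KP: "K * P = (s * q) \<cdot>\<^sub>m Q"
  unfolding s_def by (rule KP')

lemmas Qe = mp_eval_carrier[OF Q, of \<alpha>]

text \<open>Computing \<open>K * P * F\<close> in two ways gives q Q F = s K W, so
  \<open>Q * F\<close> vanishes at \<alpha> along with \<open>P * F\<close>, and coprimeness
  applies.\<close>

lemma eval_eq_0_if_double:
  assumes F: "F \<in> carrier_mat p p" and W: "W \<in> carrier_mat p p" and PF: "P * F = s \<cdot>\<^sub>m (s \<cdot>\<^sub>m W)"
  shows "mp_eval F \<alpha> = 0\<^sub>m p p"
proof (rule coprime_at)
  note Fe = mp_eval_carrier[OF F, of \<alpha>]
  have sW: "s \<cdot>\<^sub>m W \<in> carrier_mat p p" using W by simp
  show "mp_eval F \<alpha> \<in> carrier_mat p p" by (rule Fe)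
  have "mp_eval P \<alpha> * mp_eval F \<alpha> = 0 \<cdot>\<^sub>m (0 \<cdot>\<^sub>m mp_eval W \<alpha>)"
    using arg_cong[OF PF, of "\<lambda>F. mp_eval F \<alpha>"]
    by (simp add: mp_eval_mult[OF P F] mp_eval_smult s)
  also have "\<dots> = 0\<^sub>m p p" using W by (intro eq_matI) auto
  finally show "mp_eval P \<alpha> * mp_eval F \<alpha> = 0\<^sub>m p p" .
  have "s \<cdot>\<^sub>m (q \<cdot>\<^sub>m (Q * F)) = (s * q) \<cdot>\<^sub>m (Q * F)"
    by (intro eq_matI) (auto simp: mult.assoc)
  also have "\<dots> = K * P * F"
    unfolding KP by (rule mult_smult_assoc_mat[OF Q F, symmetric])
  also have "\<dots> = s \<cdot>\<^sub>m (K * (s \<cdot>\<^sub>m W))"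
    unfolding assoc_mult_mat[OF K P F] PF by (rule mult_smult_distrib[OF K sW])
  finally have "q \<cdot>\<^sub>m (Q * F) = K * (s \<cdot>\<^sub>m W)" by (rule smult_mat_cancel) (rule s)
  also have "\<dots> = s \<cdot>\<^sub>m (K * W)" by (rule mult_smult_distrib[OF K W])
  finally have "poly q \<alpha> \<cdot>\<^sub>m (mp_eval Q \<alpha> * mp_eval F \<alpha>) = 0 \<cdot>\<^sub>m mp_eval (K * W) \<alpha>"
    unfolding mp_eval_mult[OF Q F, symmetric] mp_eval_smult[symmetric] by (simp add: mp_eval_smult s)
  also have "\<dots> = poly q \<alpha> \<cdot>\<^sub>m 0\<^sub>m p p" using K W by (intro eq_matI) auto
  finally show "mp_eval Q \<alpha> * mp_eval F \<alpha> = 0\<^sub>m p p" by (rule smult_mat_cancel) (rule q)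
qed

text \<open>A null vector of \<open>M \<alpha>\<close> would be a Jordan chain of length two of \<open>P\<close> at \<open>\<alpha>\<close>.\<close>

lemma det_M: "Determinant.det (mp_eval M \<alpha>) \<noteq> 0"
proof
  assume "Determinant.det (mp_eval M \<alpha>) = 0"
  then obtain v where v: "v \<in> carrier_vec p" "v \<noteq> 0\<^sub>v p" "mp_eval M \<alpha> *\<^sub>v v = 0\<^sub>v p"
    using det_0_iff_vec_prod_zero_field[OF Me] by blast
  define V where "V = Matrix.mat p p (\<lambda>(i, j). vec_index v i)"
  have V: "V \<in> carrier_mat p p" by (simp add: V_def)
  note cV = const_mp_carrier[OF V]
  have colV: "col V j = v" if "j < p" for j using that v by (auto simp: V_def)
  have "(mp_eval M \<alpha> * V) $$ (i, j) = vec_index (mp_eval M \<alpha> *\<^sub>v v) i" if "i < p" "j < p" for i j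
    using that M V colV by simp
  then have "mp_eval M \<alpha> * V = 0\<^sub>m p p"
    unfolding v(3) using M V by (intro eq_matI) auto
  then have "mp_eval (M * const_mp V) \<alpha> = 0\<^sub>m p p"
    by (simp add: mp_eval_mult[OF M cV])
  then obtain W where W: "W \<in> carrier_mat p p" "M * const_mp V = s \<cdot>\<^sub>m W"
    unfolding s_def by (rule mp_eval_eq_0_factor[OF mult_carrier_mat[OF M cV]])
  note DV = mult_carrier_mat[OF split_diag_carrier cV] and DV' = mult_carrier_mat[OF split_diag_carrier V]
  \<comment> \<open>Since \<open>M * const_mp V\<close> is divisible by \<open>s\<close>, this
    product vanishes to second order. Its right factor must then vanish at \<alpha>, which kills the
    first \<open>d\<close> entries of \<open>v\<close>.\<close>
  have "P * (const_mp T * (split_diag p d 1 s * const_mp V)) = s \<cdot>\<^sub>m (s \<cdot>\<^sub>m W)"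
    unfolding P_mult_complement[OF cV] W(2) ..
  then have "mp_eval (const_mp T * (split_diag p d 1 s * const_mp V)) \<alpha> = 0\<^sub>m p p"
    by (rule eval_eq_0_if_double[OF mult_carrier_mat[OF cT DV] W(1)])
  then have "T * (split_diag p d 1 0 * V) = 0\<^sub>m p p"
    by (simp add: mp_eval_mult[OF cT DV] mp_eval_mult[OF split_diag_carrier cV] mp_eval_split_diag s)
  then have 0: "split_diag p d 1 0 * V = 0\<^sub>m p p"
    by (rule mult_left_cancel_det[OF T T0 DV'])
  have low: "vec_index v i = 0" if "i < d" for i
    using arg_cong[OF 0, of "\<lambda>X. X $$ (i, i)"] that dp split_diag_mult_index[OF V, of i i d 1 0]
    by (simp add: V_def)
  \<comment> \<open>Hence P(\<alpha>) T v = M(\<alpha>) v = 0, and \<open>ker\<close> kills the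
    remaining entries of \<open>v\<close>.\<close>
  have "split_diag p d 0 1 *\<^sub>v v = v"
    using low v(1) by (intro eq_vecI)
      (auto simp: split_diag_def scalar_prod_def if_distrib[of "\<lambda>x. x * _"] sum.delta' cong: if_cong)
  then have "mp_eval P \<alpha> *\<^sub>v (T *\<^sub>v v) = 0\<^sub>v p"
    using assoc_mult_mat_vec[OF Pe T v(1)]
      assoc_mult_mat_vec[OF Me split_diag_carrier v(1), of d 0 1] v(3) by (simp add: P_eval_mult_T)
  then have "vec_index v k = 0" if "k < p" for k
    using ker[OF v(1)] low that by (cases "k < d") auto
  then have "v = 0\<^sub>v p" using v(1) by (intro eq_vecI) auto
  with v(2) show False by blast
qed

lemma g_nonzero: "poly g \<alpha> \<noteq> 0" "g \<noteq> 0"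
  using det_M T0 poly_g by auto

lemma order_det_P: "Polynomial.order \<alpha> (Determinant.det P) = d"
proof -
  have "\<not> s dvd g" using g_nonzero by (simp add: s_def poly_eq_0_iff_dvd)
  then have "\<not> s ^ Suc d dvd Determinant.det P" using s by (simp add: det_P)
  moreover have "s ^ d dvd Determinant.det P" by (simp add: det_P)
  ultimately show ?thesis unfolding s_def by (intro order_unique_lemma)
qed

text \<open>Multiplying \<open>K * P\<close> by the adjugate of \<open>P\<close> gives
  \<open>det P\<close> times \<open>K\<close> on one side and \<open>s ^ d * q\<close> times
  \<open>Q * N\<close> on the other. After cancelling \<open>s ^ d\<close> the identity can be
  evaluated at \<alpha>.\<close>

lemma residue_eq:
  assumes d: "d \<ge> 1"
  shows "E = (- 1 / poly g \<alpha>) \<cdot>\<^sub>m (mp_eval Q \<alpha> * mp_eval N \<alpha>)"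
proof -
  note adj = adj_mat[OF P] and QN = mult_carrier_mat[OF Q N_carrier]
  have "s ^ d \<cdot>\<^sub>m (g \<cdot>\<^sub>m K) = Determinant.det P \<cdot>\<^sub>m K"
    unfolding det_P by (intro eq_matI) (auto simp: mult.assoc)
  also have "\<dots> = K * (P * adj_mat P)"
    unfolding adj(2) using K by (simp add: mult_smult_distrib[OF K one_carrier_mat])
  also have "\<dots> = K * P * adj_mat P" by (rule assoc_mult_mat[OF K P adj(1), symmetric])
  also have "\<dots> = (s * q) \<cdot>\<^sub>m (s ^ (d - 1) \<cdot>\<^sub>m (Q * N))"
    unfolding KP mult_smult_assoc_mat[OF Q adj(1)]
    unfolding adj_P[OF g_nonzero(2) d] mult_smult_distrib[OF Q N_carrier] ..
  also have "\<dots> = (s * s ^ (d - 1)) \<cdot>\<^sub>m (q \<cdot>\<^sub>m (Q * N))"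
    by (intro eq_matI) (auto simp: ac_simps)
  also have "s * s ^ (d - 1) = s ^ d" using d by (cases d) auto
  finally have "g \<cdot>\<^sub>m K = q \<cdot>\<^sub>m (Q * N)" by (rule smult_mat_cancel) (use s in auto)
  then have gK: "poly g \<alpha> \<cdot>\<^sub>m mp_eval K \<alpha> = poly q \<alpha> \<cdot>\<^sub>m (mp_eval Q \<alpha> * mp_eval N \<alpha>)"
    unfolding mp_eval_mult[OF Q N_carrier, symmetric] mp_eval_smult[symmetric] by simp
  have "poly q \<alpha> \<cdot>\<^sub>m ((- poly g \<alpha>) \<cdot>\<^sub>m E) = poly g \<alpha> \<cdot>\<^sub>m mp_eval K \<alpha>"
    unfolding KE by (intro eq_matI) auto
  also note gK
  finally have "(- poly g \<alpha>) \<cdot>\<^sub>m E = mp_eval Q \<alpha> * mp_eval N \<alpha>"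
    by (rule smult_mat_cancel) (rule q)
  from this[symmetric] show ?thesis using g_nonzero E by (auto intro!: eq_matI)
qed

text \<open>Differentiation strips the powers of \<open>s\<close>: the determinant yields d!
  g(\<alpha>) and the adjugate (d-1)! N(\<alpha>). The quotient of the factorials accounts for the
  factor \<open>d\<close>.\<close>

lemma residue_formula:
  assumes d: "d \<ge> 1"
  shows "E = (- of_nat d / poly ((pderiv ^^ d) (Determinant.det P)) \<alpha>) \<cdot>\<^sub>m
    (mp_eval Q \<alpha> * mp_eval (mp_deriv (d - 1) (adj_mat P)) \<alpha>)"
proof -
  have derP: "poly ((pderiv ^^ d) (Determinant.det P)) \<alpha> = fact d * poly g \<alpha>"
    unfolding det_P s_def by (rule poly_higher_pderiv_power)
  have derN: "mp_eval (mp_deriv (d - 1) (adj_mat P)) \<alpha> = fact (d - 1) \<cdot>\<^sub>m mp_eval N \<alpha>"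
    unfolding adj_P[OF g_nonzero(2) d]
    by (intro eq_matI) (auto simp: mp_eval_def mp_deriv_def s_def poly_higher_pderiv_power)
  have "fact d = of_nat d * (fact (d - 1) :: complex)" using d by (simp add: fact_reduce)
  then have c: "- of_nat d / (fact d * poly g \<alpha>) * fact (d - 1) = - 1 / poly g \<alpha>"
    using d g_nonzero by (simp add: divide_simps)
  have "(- of_nat d / (fact d * poly g \<alpha>)) \<cdot>\<^sub>m (fact (d - 1) \<cdot>\<^sub>m (mp_eval Q \<alpha> * mp_eval N \<alpha>)) = E"
    unfolding residue_eq[OF d] c[symmetric] by (intro eq_matI) (auto simp: mult.assoc)
  then show ?thesis
    unfolding derP derN mult_smult_distrib[OF Qe mp_eval_carrier[OF N_carrier]] by simp
qed

text \<open>If \<open>E\<close> vanished, \<open>s\<close> would divide \<open>K\<close> and cancel,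
  leaving K' P = q Q. Then Q(\<alpha>) would annihilate the nontrivial kernel of P(\<alpha>),
  against coprimeness.\<close>

lemma residue_nonzero:
  assumes d: "d \<ge> 1"
  shows "E \<noteq> 0\<^sub>m p p"
proof
  assume "E = 0\<^sub>m p p"
  then have "mp_eval K \<alpha> = 0\<^sub>m p p" unfolding KE by simp
  then obtain K' where K': "K' \<in> carrier_mat p p" "K = s \<cdot>\<^sub>m K'"
    unfolding s_def by (rule mp_eval_eq_0_factor[OF K])
  have "s \<cdot>\<^sub>m (K' * P) = K * P" unfolding K'(2) by (rule mult_smult_assoc_mat[OF K'(1) P, symmetric])
  also have "\<dots> = s \<cdot>\<^sub>m (q \<cdot>\<^sub>m Q)" unfolding KP by (intro eq_matI) (auto simp: mult.assoc)
  finally have "K' * P = q \<cdot>\<^sub>m Q" by (rule smult_mat_cancel) (rule s)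
  then have QK: "mp_eval K' \<alpha> * mp_eval P \<alpha> = poly q \<alpha> \<cdot>\<^sub>m mp_eval Q \<alpha>"
    unfolding mp_eval_mult[OF K'(1) P, symmetric] mp_eval_smult[symmetric] by simp
  \<comment> \<open>The first \<open>d\<close> columns of this matrix are those of \<open>T\<close>,
    which lie in the kernel of P(\<alpha>); the others are zero.\<close>
  let ?F = "T * split_diag p d 1 0"
  have D: "split_diag p d x y \<in> carrier_mat p p" for x y :: complex by simp
  note F = mult_carrier_mat[OF T D, of 1 0]
  have "mp_eval P \<alpha> * ?F = mp_eval M \<alpha> * (split_diag p d 0 1 * split_diag p d 1 0)"
    unfolding assoc_mult_mat[OF Pe T D, symmetric] assoc_mult_mat[OF Me D D, symmetric]
      P_eval_mult_T ..
  also have "split_diag p d 0 1 * split_diag p d 1 0 = (0\<^sub>m p p :: complex mat)"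
    unfolding split_diag_mult by (intro eq_matI) (auto simp: split_diag_def)
  finally have PF: "mp_eval P \<alpha> * ?F = 0\<^sub>m p p"
    unfolding right_mult_zero_mat[OF Me] .
  have "poly q \<alpha> \<cdot>\<^sub>m (mp_eval Q \<alpha> * ?F) = mp_eval K' \<alpha> * (mp_eval P \<alpha> * ?F)"
    unfolding assoc_mult_mat[OF mp_eval_carrier[OF K'(1)] Pe F, symmetric] QK
    by (rule mult_smult_assoc_mat[OF Qe F, symmetric])
  also have "\<dots> = poly q \<alpha> \<cdot>\<^sub>m 0\<^sub>m p p" unfolding PF using K'(1) by simp
  finally have "mp_eval Q \<alpha> * ?F = 0\<^sub>m p p" by (rule smult_mat_cancel) (rule q)
  from mult_left_cancel_det[OF T T0 D coprime_at[OF F PF this]]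
  have "split_diag p d 1 0 = (0\<^sub>m p p :: complex mat)" .
  from arg_cong[OF this, of "\<lambda>X. X $$ (0, 0)"] show False
    using d dp by (simp add: split_diag_def)
qed

text \<open>Inserting the definition of \<open>N\<close> writes \<open>E\<close> as diag(c, ..., c,
  0, ..., 0) between the invertible matrices Q(\<alpha>) T and adj M(\<alpha>), with all scalars
  absorbed into \<open>c\<close>.\<close>

lemma rank_residue:
  assumes d: "d \<ge> 1" and Q0: "Determinant.det (mp_eval Q \<alpha>) \<noteq> 0"
  shows "vec_space.rank p E = d"
proof -
  define c where "c = - 1 / (poly g \<alpha> * Determinant.det T)"
  have c: "c \<noteq> 0" using g_nonzero T0 by (simp add: c_def)
  define W where "W = mp_eval (adj_mat M) \<alpha>"
  note aM = adj_mat[OF M]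
  have W: "W \<in> carrier_mat p p" unfolding W_def by (rule mp_eval_carrier[OF aM(1)])
  have D: "split_diag p d x y \<in> carrier_mat p p" for x y :: "'a :: comm_ring_1" by simp
  note U = mult_carrier_mat[OF Qe T] and SW = mult_carrier_mat[OF D W, of 1 0]
  note TSW = mult_carrier_mat[OF T SW]
  have N: "mp_eval N \<alpha> = (1 / Determinant.det T) \<cdot>\<^sub>m (T * (split_diag p d 1 0 * W))"
    unfolding N_def mp_eval_smult mp_eval_mult[OF cT mult_carrier_mat[OF D aM(1)]]
      mp_eval_mult[OF D aM(1)] mp_eval_split_diag W_def by (simp add: s)
  have "E = c \<cdot>\<^sub>m (mp_eval Q \<alpha> * (T * (split_diag p d 1 0 * W)))"
    unfolding residue_eq[OF d] N mult_smult_distrib[OF Qe TSW] c_def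
    by (intro eq_matI) auto
  also have "\<dots> = c \<cdot>\<^sub>m (mp_eval Q \<alpha> * T * split_diag p d 1 0 * W)"
    unfolding assoc_mult_mat[OF Qe T SW, symmetric] assoc_mult_mat[OF U D W, symmetric] ..
  also have "\<dots> = mp_eval Q \<alpha> * T * (c \<cdot>\<^sub>m split_diag p d 1 0) * W"
    unfolding mult_smult_distrib[OF U D] mult_smult_assoc_mat[OF mult_carrier_mat[OF U D] W] ..
  finally have EU: "E = mp_eval Q \<alpha> * T * split_diag p d c 0 * W"
    by (simp add: smult_split_diag)
  have "W * mp_eval M \<alpha> = mp_eval (Determinant.det M \<cdot>\<^sub>m 1\<^sub>m p) \<alpha>"
    unfolding W_def mp_eval_mult[OF aM(1) M, symmetric] aM(3) ..
  also have "\<dots> = Determinant.det (mp_eval M \<alpha>) \<cdot>\<^sub>m 1\<^sub>m p"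
    unfolding det_mp_eval by (intro eq_matI) (auto simp: mp_eval_def)
  finally have "W * ((1 / Determinant.det (mp_eval M \<alpha>)) \<cdot>\<^sub>m mp_eval M \<alpha>)
    = (1 / Determinant.det (mp_eval M \<alpha>)) \<cdot>\<^sub>m (Determinant.det (mp_eval M \<alpha>) \<cdot>\<^sub>m 1\<^sub>m p)"
    unfolding mult_smult_distrib[OF W Me] by simp
  also have "\<dots> = 1\<^sub>m p" using det_M by (intro eq_matI) auto
  finally have WM: "W * ((1 / Determinant.det (mp_eval M \<alpha>)) \<cdot>\<^sub>m mp_eval M \<alpha>) = 1\<^sub>m p" .
  have M': "(1 / Determinant.det (mp_eval M \<alpha>)) \<cdot>\<^sub>m mp_eval M \<alpha> \<in> carrier_mat p p" using Me by simp
  have "vec_space.rank p E = vec_space.rank p (mp_eval Q \<alpha> * T * split_diag p d c 0)"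
    unfolding EU by (rule rank_mult_right_invertible[OF mult_carrier_mat[OF U D] W M' WM])
  also have "\<dots> = d"
    using Q0 T0 det_mult[OF Qe T] by (intro rank_mult_split_diag[OF U _ c dp]) simp
  finally show ?thesis .
qed

end

section \<open>From local data to the theorem\<close>

lemma poly_eq_if_cofinite_eq:
  fixes f g :: "'a :: {idom, ring_char_0} poly"
  assumes "finite X" and "\<And>z. z \<notin> X \<Longrightarrow> poly f z = poly g z"
  shows "f = g"
proof (rule ccontr)
  assume "f \<noteq> g"
  then have "finite {z. poly (f - g) z = 0}" by (intro poly_roots_finite) simp
  moreover have "- X \<subseteq> {z. poly (f - g) z = 0}" using assms(2) by auto
  ultimately show False
    using assms(1) infinite_UNIV_char_0[where 'a = 'a] by (metis finite_compl finite_subset)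
qed

lemma mp_eq_if_cofinite_eq:
  assumes F: "F \<in> carrier_mat m k" and G: "G \<in> carrier_mat m k" and X: "finite X"
    and eq: "\<And>z. z \<notin> X \<Longrightarrow> mp_eval F z = mp_eval G z"
  shows "F = G"
proof (rule eq_matI)
  fix a b assume "a < dim_row G" "b < dim_col G"
  then have ab: "a < m" "b < k" using G by auto
  have "poly (F $$ (a, b)) z = poly (G $$ (a, b)) z" if "z \<notin> X" for z
    using arg_cong[OF eq[OF that], of "\<lambda>M. M $$ (a, b)"] ab F G by (simp add: mp_eval_def)
  then show "F $$ (a, b) = G $$ (a, b)" by (rule poly_eq_if_cofinite_eq[OF X])
qed (use F G in auto)

theorem corollary2p11:
  fixes p n r :: nat
    and P Q :: "complex poly mat"
    and R :: "complex \<Rightarrow> complex mat"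
    and A B :: "complex mat"
    and E :: "nat \<Rightarrow> complex mat"
    and lam :: "nat \<Rightarrow> complex"
    and l :: "nat \<Rightarrow> nat"
  assumes "p \<ge> 1"
    and "rational_mat_fun p R"
    and "self_adjoint_mat_fun p R"
    and "Q \<in> carrier_mat p p"
    and "mp_monic_of_degree p P n" and "n \<ge> 1"
    and "\<forall>z. z \<notin> mp_zeros P \<longrightarrow> R z = mp_eval Q z * the (mat_inverse (mp_eval P z))"
    and "right_coprime p Q P"
    and "herglotz_nevanlinna p R"
    and "\<forall>z. z \<notin> lam ` {1..r} \<longrightarrow> R z = herglotz_expansion p A B r E lam z"
    and "nonneg_definite p A"
    and "B \<in> carrier_mat p p" and "mat_adjoint B = B"
    and "\<forall>j\<in>{1..r}. nonneg_definite p (E j)"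
    and "inj_on lam {1..r}"
    and "lam ` {1..r} \<subseteq> mp_zeros P \<inter> \<real>"
    and "\<forall>j\<in>{1..r}. l j = mp_mult P (lam j)"
  shows "mp_simple P \<and> mp_zeros P \<subseteq> \<real> \<and> lam ` {1..r} = mp_zeros P \<and>
    (\<forall>j\<in>{1..r}. E j =
       (- of_nat (l j) / poly ((pderiv ^^ l j) (Determinant.det P)) (lam j)) \<cdot>\<^sub>m
         (mp_eval Q (lam j) * mp_eval (mp_deriv (l j - 1) (adj_mat P)) (lam j))) \<and>
    (\<forall>j\<in>{1..r}. E j \<noteq> 0\<^sub>m p p) \<and>
    (mp_zeros P \<inter> mp_zeros Q = {} \<longrightarrow> (\<forall>j\<in>{1..r}. vec_space.rank p (E j) = l j))"
proof -
  have P: "P \<in> carrier_mat p p" using assms(5) by (simp add: mp_monic_of_degree_def mp_has_degree_def)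
  have P0: "Determinant.det P \<noteq> 0" by (rule det_monic_nonzero[OF assms(5)])
  have zeros: "mp_zeros P = {z. poly (Determinant.det P) z = 0}"
    by (simp add: mp_zeros_def det_mp_eval)
  have fin: "finite (mp_zeros P)" unfolding zeros by (rule poly_roots_finite[OF P0])
  have A: "A \<in> carrier_mat p p" using assms(11) by (simp add: nonneg_definite_def)
  have lam: "lam ` {1..r} \<subseteq> mp_zeros P" using assms(16) by simp
  have R: "R z * mp_eval P z = mp_eval Q z" if z: "z \<notin> mp_zeros P" for z
  proof -
    have Pz: "mp_eval P z \<in> carrier_mat p p" using P by simp
    have "Determinant.det (mp_eval P z) \<noteq> 0" using z by (simp add: mp_zeros_def)
    then have "mp_eval P z \<in> Units (ring_mat TYPE(complex) p ())"
      by (rule det_non_zero_imp_unit[OF Pz])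
    \<comment> \<open>Off the zeros of \<open>P\<close> the result of \<open>mat_inverse\<close> is
      not \<open>None\<close>, so \<open>the\<close> returns a genuine inverse.\<close>
    with mat_inverse(1)[OF Pz, where b = "()"] obtain I where I: "mat_inverse (mp_eval P z) = Some I"
      by (cases "mat_inverse (mp_eval P z)") auto
    with mat_inverse(2)[OF Pz] have inv: "I * mp_eval P z = 1\<^sub>m p" "I \<in> carrier_mat p p" by auto
    have Rz: "R z = mp_eval Q z * I" using assms(7) z I by simp
    show ?thesis
      unfolding Rz assoc_mult_mat[OF mp_eval_carrier[OF assms(4)] inv(2) Pz] inv(1)
      using assms(4) by simp
  qed
  \<comment> \<open>Indexing residues by points treats every zero of \<open>P\<close> alike,
    including one that might not occur among the \<open>lam j\<close>.\<close>
  define E0 where "E0 \<alpha> = Matrix.mat p p (\<lambda>(a, b). \<Sum>j | j \<in> {1..r} \<and> lam j = \<alpha>. E j $$ (a, b))" for \<alpha>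
  have E0_lam: "E0 (lam j) = E j" if j: "j \<in> {1..r}" for j
  proof -
    have j': "{i. i \<in> {1..r} \<and> lam i = lam j} = {j}" using j inj_onD[OF assms(15)] by blast
    have "E j \<in> carrier_mat p p" using assms(14) j by (simp add: nonneg_definite_def)
    then show ?thesis unfolding E0_def j' by (intro eq_matI) simp_all
  qed
  have E0_out: "E0 \<alpha> = 0\<^sub>m p p" if "\<alpha> \<notin> lam ` {1..r}" for \<alpha>
  proof -
    have 0: "{i. i \<in> {1..r} \<and> lam i = \<alpha>} = {}" using that by blast
    show ?thesis unfolding E0_def 0 by (intro eq_matI) simp_all
  qed
  have key: "mp_mult P \<alpha> = kernel_dim (mp_eval P \<alpha>) \<and> E0 \<alpha> \<noteq> 0\<^sub>m p p \<and>
      E0 \<alpha> = (- of_nat (mp_mult P \<alpha>) / poly ((pderiv ^^ mp_mult P \<alpha>) (Determinant.det P)) \<alpha>) \<cdot>\<^sub>m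
         (mp_eval Q \<alpha> * mp_eval (mp_deriv (mp_mult P \<alpha> - 1) (adj_mat P)) \<alpha>) \<and>
      (\<alpha> \<notin> mp_zeros Q \<longrightarrow> vec_space.rank p (E0 \<alpha>) = mp_mult P \<alpha>)"
    if \<alpha>: "\<alpha> \<in> mp_zeros P" for \<alpha>
  proof -
    obtain K q where K: "K \<in> carrier_mat p p" and q: "poly q \<alpha> \<noteq> 0"
      and KE: "mp_eval K \<alpha> = (- poly q \<alpha>) \<cdot>\<^sub>m E0 \<alpha>"
      and Kz: "\<And>z. z \<notin> lam ` {1..r} \<Longrightarrow>
        mp_eval K z = ((z - \<alpha>) * poly q z) \<cdot>\<^sub>m herglotz_expansion p A B r E lam z"
      unfolding E0_def
      by (rule herglotz_expansion_clear_poles[OF A assms(12), where \<alpha> = \<alpha> and r = r and lam = lam and E = E])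
        blast
    \<comment> \<open>Off the finite set of zeros both descriptions of \<open>R\<close> hold;
      agreement there gives an identity of polynomials, valid also at \<alpha>.\<close>
    have "mp_eval (K * P) z = mp_eval (([:-\<alpha>, 1:] * q) \<cdot>\<^sub>m Q) z" if z: "z \<notin> mp_zeros P" for z
    proof -
      have zl: "z \<notin> lam ` {1..r}" using z lam by blast
      with assms(10) have Rz: "herglotz_expansion p A B r E lam z = R z" by simp
      have "R z \<in> carrier_mat p p" using assms(2) by (simp add: rational_mat_fun_def)
      then show ?thesis
        unfolding mp_eval_mult[OF K P] Kz[OF zl] Rz mp_eval_smult R[OF z, symmetric]
        using mult_smult_assoc_mat[OF _ mp_eval_carrier[OF P]] by (simp add: algebra_simps)
    qed
    then have KP: "K * P = ([:-\<alpha>, 1:] * q) \<cdot>\<^sub>m Q"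
      using fin K P assms(4) by (intro mp_eq_if_cofinite_eq[of _ p p]) auto
    obtain T M where "T \<in> carrier_mat p p" "Determinant.det T \<noteq> 0" "M \<in> carrier_mat p p"
      "kernel_dim (mp_eval P \<alpha>) \<le> p"
      "P * const_mp T = M * split_diag p (kernel_dim (mp_eval P \<alpha>)) [:-\<alpha>, 1:] 1"
      "\<And>v k. v \<in> carrier_vec p \<Longrightarrow> mp_eval P \<alpha> *\<^sub>v (T *\<^sub>v v) = 0\<^sub>v p \<Longrightarrow>
        kernel_dim (mp_eval P \<alpha>) \<le> k \<Longrightarrow> k < p \<Longrightarrow> vec_index v k = 0"
      by (rule local_factorization[OF P, of \<alpha>]) blast
    then interpret local_fraction p "kernel_dim (mp_eval P \<alpha>)" \<alpha> P M T Q K q "E0 \<alpha>"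
      using P assms(4) K q KP KE right_coprime_eval[OF P P0 assms(4,8)]
      by unfold_locales (auto simp: E0_def)
    have mult: "mp_mult P \<alpha> = kernel_dim (mp_eval P \<alpha>)"
      using order_det_P by (simp add: mp_mult_def)
    have "poly (Determinant.det P) \<alpha> = 0" using \<alpha> by (simp add: zeros)
    then have d: "kernel_dim (mp_eval P \<alpha>) \<ge> 1"
      using P0 order_root[of "Determinant.det P" \<alpha>] order_det_P by (simp add: Suc_le_eq)
    show ?thesis
      unfolding mult using residue_nonzero[OF d] residue_formula[OF d] rank_residue[OF d]
      by (simp add: mp_zeros_def)
  qed
  \<comment> \<open>A zero of \<open>P\<close> missing from the list would have \<open>E0\<close>
    equal to zero, contrary to \<open>key\<close>. Reality of all zeros follows from this
    equality.\<close>
  have zl: "lam ` {1..r} = mp_zeros P"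
    using lam key E0_out by blast
  have simple: "mp_simple P" unfolding mp_simple_def mp_regular_def using P0 key by blast
  have keyj: "mp_mult P (lam j) = kernel_dim (mp_eval P (lam j)) \<and> E j \<noteq> 0\<^sub>m p p \<and>
      E j = (- of_nat (l j) / poly ((pderiv ^^ l j) (Determinant.det P)) (lam j)) \<cdot>\<^sub>m
         (mp_eval Q (lam j) * mp_eval (mp_deriv (l j - 1) (adj_mat P)) (lam j)) \<and>
      (lam j \<notin> mp_zeros Q \<longrightarrow> vec_space.rank p (E j) = l j)" if j: "j \<in> {1..r}" for j
  proof -
    have lj: "l j = mp_mult P (lam j)" using assms(17) j by blast
    have "lam j \<in> mp_zeros P" using lam j by blast
    from key[OF this] show ?thesis unfolding E0_lam[OF j] lj .
  qed
  show ?thesis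
  proof (intro conjI ballI impI)
    show "mp_zeros P \<subseteq> \<real>" using assms(16) zl by simp
    fix j assume j: "j \<in> {1..r}"
    show "E j = (- of_nat (l j) / poly ((pderiv ^^ l j) (Determinant.det P)) (lam j)) \<cdot>\<^sub>m
        (mp_eval Q (lam j) * mp_eval (mp_deriv (l j - 1) (adj_mat P)) (lam j))"
      using keyj[OF j] by (elim conjE)
    show "E j \<noteq> 0\<^sub>m p p" using keyj[OF j] by (elim conjE)
    assume disj: "mp_zeros P \<inter> mp_zeros Q = {}"
    have "lam j \<notin> mp_zeros Q" using disj lam j by blast
    then show "vec_space.rank p (E j) = l j" using keyj[OF j] by (elim conjE) (rule mp)
  qed (rule simple zl)+
qed

end
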